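(* Assume that the collision kernel has separated form with exponent $\beta\in(1-D,2]$. Let $t_0\in\mathbb R$ and let $F\equiv F(v,x,t)$ be a mild solution of the Boltzmann equation defined a.e. on $\mathbb R^D\times\mathbb R^D\times(t_0,+\infty)$ (resp. on $\mathbb R^D\times\mathbb R^D\times(-\infty,t_0)$). Assume that, for some global Maxwellian $\mathcal M$, $$|F(v,x,t)|\le\mathcal M(v,x,t)$$ for a.e. $(v,x,t)\in\mathbb R^D\times\mathbb R^D\times(t_0,+\infty)$ (resp. $\mathbb R^D\times\mathbb R^D\times(-\infty,t_0)$). Then there exists a unique $F^{+\infty}\equiv F^{+\infty}(v,x)$ (resp. $F^{-\infty}\equiv F^{-\infty}(v,x)$) such that $$\|F(t)-e^{-t\mathsf A}F^{+\infty}\|_{L^1(\mathbb R^D\times\mathbb R^D)}\to0\quad\text{as }t\to+\infty$$ (resp. $\|F(t)-e^{-t\mathsf A}F^{-\infty}\|_{L^1(\mathbb R^D\times\mathbb R^D)}\to0$ as $t\to-\infty$). When $0$ belongs to the time interval on which $F$ is defined, writing $F^{\mathrm{in}}:=F(0)$, these functions are given by $$F^{+\infty}=F^{\mathrm{in}}+\int_0^{\infty}e^{s\mathsf A}\mathcal B(F,F)(s)\,ds,\qquad\text{resp.}\qquad F^{-\infty}=F^{\mathrm{in}}-\int_{-\infty}^0e^{s\mathsf A}\mathcal B(F,F)(s)\,ds.$$ Moreover they satisfy the bound $$|F^{\pm\infty}(v,x)|\le\mathcal M(v,x,0)\quad\text{for a.e. }(v,x)\in\mathbb R^D\times\mathbb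 R^D.$$
   Context: Collision kernel and collision integral. $D\ge1$ is an integer. A collision kernel of separated form with exponent $\beta$ is $\mathsf b(z,\omega)=|z|^\beta\hat{\mathsf b}(\omega\cdot z/|z|)$, $z\in\mathbb R^D$, $\omega\in\mathbb S^{D-1}$, where $\hat{\mathsf b}\ge0$ is measurable and $\bar{\mathsf b}:=\int_{\mathbb S^{D-1}}\hat{\mathsf b}(\omega\cdot n)\,d\omega<\infty$ ($n$ any unit vector). With $v'=v-((v-v_* )\cdot\omega)\omega$ and $v_*'=v_*+((v-v_* )\cdot\omega)\omega$, the collision integral is $$\mathcal B(F,F)(v,x,t)=\iint_{\mathbb S^{D-1}\times\mathbb R^D}\big(F(v',x,t)F(v'_*,x,t)-F(v,x,t)F(v_*,x,t)\big)\mathsf b(v-v_*,\omega)\,d\omega\,dv_*.$$ The Boltzmann equation is $\partial_tF+v\cdot\nabla_xF=\mathcal B(F,F)$. Functions $F$ are real valued. Global Maxwellians (of finite mass) are the functions $$\mathcal M(v,x,t)=\frac{m}{(2\pi)^D}\sqrt{\det Q}\;e^{-q(v-v_0,x-x_0,t)},\qquad q(v,x,t)=\tfrac12\big(c|v|^2+a|x-tv|^2+2b(x-tv)\cdot v\big)-v\cdot B(x-tv),$$ with $m,a,c>0$, $b\in\mathbb R$, $x_0,v_0\in\mathbb R^D$, $B$ a real skew-symmetric $D\times D$ matrix such that $Q:=(ac-b^2)I+B^2$ is positive definite. They satisfy $\partial_t\mathcal M+v\cdot\nabla_x\mathcal M=0$ and $\mathcal B(\mathcal M,\mathcal M)=0$.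 Mild solutions: $e^{t\mathsf A}$ is defined by $(e^{t\mathsf A}\phi)(v,x)=\phi(v,x+tv)$. A mild solution on $\mathbb R^D\times\mathbb R^D\times I$ ($I\subset\mathbb R$ an interval) is $F\in L^1_{loc}(\mathbb R^D\times\mathbb R^D\times I)$ with $\mathcal B(F,F)\in L^1_{loc}(\mathbb R^D\times\mathbb R^D\times I)$ and $$e^{t_2\mathsf A}F(v,x,t_2)=e^{t_1\mathsf A}F(v,x,t_1)+\int_{t_1}^{t_2}e^{s\mathsf A}\mathcal B(F,F)(v,x,s)\,ds$$ for a.e. $(v,x)\in\mathbb R^D\times\mathbb R^D$ and all $t_1,t_2\in I$. $F$ is identified with its representative in $C(I;L^1_{loc}(\mathbb R^D\times\mathbb R^D))$, and $F(t)$ denotes $(v,x)\mapsto F(v,x,t)$. *)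

theory Defs
  imports "HOL-Analysis.Analysis"
begin

text \<open>
  \<open>\<real>\<^sup>D\<close> is \<open>real ^ 'n\<close> with \<open>D = CARD('n)\<close>; phase space and space-time carry their Lebesgue measure.

  Surface measure on the unit sphere, as the cone measure: the measure of \<open>A\<close> is \<open>D\<close> times the volume
  of \<open>{r w | 0 < r \<le> 1, w \<in> A}\<close> (see \<open>emeasure_sphere_measure\<close>). In dimension one this is the
  counting measure on \<open>{-1, 1}\<close>.
\<close>

definition sphere_measure :: "'a::euclidean_space measure" where
  "sphere_measure =
     scale_measure (of_nat DIM('a))
       (distr (restrict_space lborel (cball 0 1 - {0})) (restrict_space borel (sphere 0 1))
         (\<lambda>x. x /\<^sub>R norm x))"

lemma space_sphere_measure: "space (sphere_measure :: 'a::euclidean_space measure) = sphere 0 1"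
  by (simp add: sphere_measure_def space_restrict_space space_scale_measure)

lemma sets_sphere_measure:
  "sets (sphere_measure :: 'a::euclidean_space measure) = sets (restrict_space borel (sphere 0 1))"
  by (simp add: sphere_measure_def)

lemma emeasure_sphere_measure:
  fixes A :: "'a::euclidean_space set"
  assumes "A \<in> sets borel" "A \<subseteq> sphere 0 1"
  shows "emeasure sphere_measure A =
    of_nat DIM('a) * emeasure lborel {x \<in> cball 0 1 - {0}. x /\<^sub>R norm x \<in> A}"
proof -
  let ?R = "restrict_space lborel (cball 0 1 - {0 :: 'a})"
  have f: "(\<lambda>x. x /\<^sub>R norm x) \<in> measurable ?R (restrict_space borel (sphere (0::'a) 1))"
    by (rule measurable_restrict_space2)
      (auto simp: space_restrict_space intro!: measurable_restrict_space1)
  have A: "A \<in> sets (restrict_space borel (sphere (0::'a) 1))"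
    using assms by (auto simp: sets_restrict_space_iff)
  have "emeasure (distr ?R (restrict_space borel (sphere 0 1)) (\<lambda>x. x /\<^sub>R norm x)) A =
      emeasure ?R {x \<in> cball 0 1 - {0}. x /\<^sub>R norm x \<in> A}"
    by (subst emeasure_distr[OF f A], rule arg_cong2[where f=emeasure])
      (auto simp: space_restrict_space)
  also have "\<dots> = emeasure lborel {x \<in> cball 0 1 - {0}. x /\<^sub>R norm x \<in> A}"
    by (rule emeasure_restrict_space) auto
  finally show ?thesis
    by (simp add: sphere_measure_def)
qed

text \<open>
  Collision kernels \<open>k z \<omega> = |z|\<^sup>\<beta> h (\<omega> \<cdot> z/|z|)\<close>. Completions are taken because the angular part
  \<open>h\<close> is only assumed to be Lebesgue measurable.
\<close>

definition separated_kernel :: "real \<Rightarrow> (real ^ 'n \<Rightarrow> real ^ 'n \<Rightarrow> real) \<Rightarrow> bool" where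
  "separated_kernel \<beta> k \<longleftrightarrow>
     (\<exists>h :: real \<Rightarrow> real.
        h \<in> borel_measurable (lebesgue_on {-1..1}) \<and>
        (\<forall>s\<in>{-1..1}. 0 \<le> h s) \<and>
        (\<forall>n :: real ^ 'n. norm n = 1 \<longrightarrow>
           integrable (completion sphere_measure) (\<lambda>\<omega>. h (\<omega> \<bullet> n))) \<and>
        (\<forall>z \<omega>. z \<noteq> 0 \<and> norm \<omega> = 1 \<longrightarrow>
           k z \<omega> = norm z powr \<beta> * h (\<omega> \<bullet> (z /\<^sub>R norm z))))"

definition post1 :: "real ^ 'n \<Rightarrow> real ^ 'n \<Rightarrow> real ^ 'n \<Rightarrow> real ^ 'n" where
  "post1 v w \<omega> = v - ((v - w) \<bullet> \<omega>) *\<^sub>R \<omega>"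

definition post2 :: "real ^ 'n \<Rightarrow> real ^ 'n \<Rightarrow> real ^ 'n \<Rightarrow> real ^ 'n" where
  "post2 v w \<omega> = w + ((v - w) \<bullet> \<omega>) *\<^sub>R \<omega>"

definition collision_integrand ::
  "(real ^ 'n \<Rightarrow> real ^ 'n \<Rightarrow> real) \<Rightarrow> ((real ^ 'n) \<times> (real ^ 'n) \<times> real \<Rightarrow> real) \<Rightarrow>
   (real ^ 'n) \<times> (real ^ 'n) \<times> real \<Rightarrow> (real ^ 'n) \<times> (real ^ 'n) \<Rightarrow> real" where
  "collision_integrand k F = (\<lambda>(v, x, t) (\<omega>, w).
     (F (post1 v w \<omega>, x, t) * F (post2 v w \<omega>, x, t) - F (v, x, t) * F (w, x, t)) * k (v - w) \<omega>)"

abbreviation collision_measure :: "((real ^ 'n) \<times> (real ^ 'n)) measure" where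
  "collision_measure \<equiv> completion (sphere_measure \<Otimes>\<^sub>M lborel)"

definition collision ::
  "(real ^ 'n \<Rightarrow> real ^ 'n \<Rightarrow> real) \<Rightarrow> ((real ^ 'n) \<times> (real ^ 'n) \<times> real \<Rightarrow> real) \<Rightarrow>
   (real ^ 'n) \<times> (real ^ 'n) \<times> real \<Rightarrow> real" where
  "collision k F p = integral\<^sup>L collision_measure (collision_integrand k F p)"

definition global_maxwellian :: "((real ^ 'n) \<times> (real ^ 'n) \<times> real \<Rightarrow> real) \<Rightarrow> bool" where
  "global_maxwellian M \<longleftrightarrow>
     (\<exists>(m::real) (a::real) (c::real) (b::real) (x0::real ^ 'n) (v0::real ^ 'n) (B::real ^ 'n ^ 'n).
        let Q = (a * c - b\<^sup>2) *\<^sub>R mat 1 + B ** B;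
            q = (\<lambda>v x t. (c * (norm v)\<^sup>2 + a * (norm (x - t *\<^sub>R v))\<^sup>2
                            + 2 * b * ((x - t *\<^sub>R v) \<bullet> v)) / 2
                         - v \<bullet> (B *v (x - t *\<^sub>R v)))
        in m > 0 \<and> a > 0 \<and> c > 0 \<and> transpose B = - B \<and>
           (\<forall>y. y \<noteq> 0 \<longrightarrow> y \<bullet> (Q *v y) > 0) \<and>
           M = (\<lambda>(v, x, t). m / (2 * pi) ^ CARD('n) * sqrt (det Q) * exp (- q (v - v0) (x - x0) t)))"

text \<open>The group \<open>e\<^bsup>tA\<^esup>\<close>; its generator is \<open>v \<cdot> \<nabla>\<^sub>x\<close>.\<close>

definition transport :: "real \<Rightarrow> ((real ^ 'n) \<times> (real ^ 'n) \<Rightarrow> real) \<Rightarrow> (real ^ 'n) \<times> (real ^ 'n) \<Rightarrow> real" where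
  "transport t \<phi> = (\<lambda>(v, x). \<phi> (v, x + t *\<^sub>R v))"

definition at_time :: "((real ^ 'n) \<times> (real ^ 'n) \<times> real \<Rightarrow> real) \<Rightarrow> real \<Rightarrow> (real ^ 'n) \<times> (real ^ 'n) \<Rightarrow> real" where
  "at_time F t = (\<lambda>(v, x). F (v, x, t))"

definition L1_loc :: "'a::euclidean_space set \<Rightarrow> ('a \<Rightarrow> real) \<Rightarrow> bool" where
  "L1_loc S f \<longleftrightarrow> (\<forall>K. compact K \<and> K \<subseteq> S \<longrightarrow> f absolutely_integrable_on K)"

text \<open>
  The second condition says that the collision integral is defined almost everywhere; it has to be
  stated since \<^const>\<open>lebesgue_integral\<close> is \<open>0\<close> on non-integrable functions. Requiring the Duhamel
  formula for all times \<open>t1\<close>, \<open>t2\<close>, almost everywhere in phase space, is what selects the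
  representative of \<open>F\<close> in \<open>C(I; L\<^sup>1\<^sub>l\<^sub>o\<^sub>c)\<close>: it makes \<open>t \<mapsto> F(t)\<close> continuous into \<open>L\<^sup>1\<^sub>l\<^sub>o\<^sub>c\<close>.
\<close>

definition mild_solution ::
  "(real ^ 'n \<Rightarrow> real ^ 'n \<Rightarrow> real) \<Rightarrow> real set \<Rightarrow> ((real ^ 'n) \<times> (real ^ 'n) \<times> real \<Rightarrow> real) \<Rightarrow> bool" where
  "mild_solution k I F \<longleftrightarrow>
     L1_loc (UNIV \<times> UNIV \<times> I) F \<and>
     (AE (v, x, t) in lebesgue. t \<in> I \<longrightarrow>
        integrable collision_measure (collision_integrand k F (v, x, t))) \<and>
     L1_loc (UNIV \<times> UNIV \<times> I) (collision k F) \<and>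
     (\<forall>t1\<in>I. \<forall>t2\<in>I. AE p in lebesgue.
        transport t2 (at_time F t2) p =
          transport t1 (at_time F t1) p
          + (LINT s=t1..t2|lebesgue. transport s (at_time (collision k F) s) p))"

text \<open>Extended-real valued, hence meaningful without integrability; to be used for measurable functions only.\<close>

definition L1_norm :: "('a::euclidean_space \<Rightarrow> real) \<Rightarrow> ennreal" where
  "L1_norm f = (\<integral>\<^sup>+ p. ennreal \<bar>f p\<bar> \<partial>lebesgue)"

text \<open>Used with \<open>\<F>\<close> equal to \<^const>\<open>at_top\<close> or \<^const>\<open>at_bot\<close>.\<close>

definition asymptotic_state ::
  "real filter \<Rightarrow> ((real ^ 'n) \<times> (real ^ 'n) \<times> real \<Rightarrow> real) \<Rightarrow> ((real ^ 'n) \<times> (real ^ 'n) \<Rightarrow> real) \<Rightarrow> bool" where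
  "asymptotic_state \<F> F G \<longleftrightarrow>
     G \<in> borel_measurable lebesgue \<and>
     ((\<lambda>t. L1_norm (\<lambda>p. at_time F t p - transport (- t) G p)) \<longlongrightarrow> 0) \<F>"

end

theory Submission
  imports Defs
begin

text \<open>
  A Maxwellian is a collision invariant Gaussian, so \<open>|F| \<le> M\<close> gives
  \<open>|\<B>(F,F)| \<le> 2 C \<integral> M(v) M(w) |v - w|\<^sup>\<beta> dw\<close>. By the parallelogram identity
  \<open>|x - tv|\<^sup>2 + |x - tw|\<^sup>2 = 2 |x - t(v+w)/2|\<^sup>2 + t\<^sup>2|v - w|\<^sup>2/2\<close>, integrating \<open>M(v) M(w)\<close> over \<open>x\<close> and
  then over all times \<open>t\<close> costs a factor \<open>1/|v - w|\<close>, and \<open>|v - w|\<^bsup>\<beta>-1\<^esup>\<close> is locally integrable since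
  \<open>\<beta> - 1 > -D\<close>. Hence the collision integral along free streaming lies in \<open>L\<^sup>1(dv dx dt)\<close>, and the
  Duhamel formula shows that \<open>F\<close> along free streaming converges in \<open>L\<^sup>1\<close> as \<open>t \<rightarrow> \<plusminus>\<infinity>\<close>.
\<close>

section \<open>Lebesgue measure and measure preserving maps\<close>

text \<open>Null sets shape the proof more than estimates do. The bound by \<open>M\<close> holds
  only almost everywhere in space-time, whereas the collision integral samples \<open>F\<close> at
  v', v_*' and w; the Duhamel formula holds off a null set that depends on the pair of times,
  whereas the limit runs through all times; and the data are only Lebesgue measurable. Three devices
  answer this. The collision maps are reduced to translations at fixed relative velocity and angle.
  The collision integral in the moving frame is replaced by one integrable Borel function f of phase
  point and time; if \<Phi>(t) denotes its integral over all s \<le> t, then F(t) in the moving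
  frame minus \<Phi>(t) is a.e. independent of t, so that only \<Phi> needs a limit, and it has one
  in both directions. Finally the bound on the asymptotic state is obtained along a sequence of
  times at which |F(t)| \<le> M(t) holds a.e. in phase space.\<close>

lemma borel_measurable_comp_continuous:
  assumes "f \<in> borel_measurable borel" "continuous_on UNIV g"
  shows "(\<lambda>x. f (g x)) \<in> borel_measurable borel"
  using borel_measurable_continuous_onI[OF assms(2)] assms(1) by (rule measurable_compose)

lemma nn_integral_lborel_pair:
  fixes f :: "'a::euclidean_space \<times> 'b::euclidean_space \<Rightarrow> ennreal"
  assumes [measurable]: "f \<in> borel_measurable borel"
  shows "(\<integral>\<^sup>+p. f p \<partial>lborel) = (\<integral>\<^sup>+x. (\<integral>\<^sup>+y. f (x, y) \<partial>lborel) \<partial>lborel)"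
proof -
  have f: "f \<in> borel_measurable (lborel \<Otimes>\<^sub>M lborel)"
    by (simp add: lborel_prod)
  show ?thesis
    using lborel.nn_integral_fst[OF f] by (simp add: lborel_prod)
qed

lemma nn_integral_lborel_swap:
  fixes f :: "'a::euclidean_space \<Rightarrow> 'b::euclidean_space \<Rightarrow> ennreal"
  assumes "(\<lambda>(x, y). f x y) \<in> borel_measurable borel"
  shows "(\<integral>\<^sup>+x. (\<integral>\<^sup>+y. f x y \<partial>lborel) \<partial>lborel) = (\<integral>\<^sup>+y. (\<integral>\<^sup>+x. f x y \<partial>lborel) \<partial>lborel)"
proof -
  have "(\<lambda>(x, y). f x y) \<in> borel_measurable (lborel \<Otimes>\<^sub>M lborel)"
    using assms by (simp add: lborel_prod)
  from lborel_pair.Fubini'[OF this] show ?thesis by simp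
qed

lemma nn_integral_lborel_translate:
  fixes f :: "'a::euclidean_space \<Rightarrow> ennreal"
  assumes [measurable]: "f \<in> borel_measurable borel"
  shows "(\<integral>\<^sup>+x. f (c + x) \<partial>lborel) = (\<integral>\<^sup>+x. f x \<partial>lborel)"
proof -
  have "(\<integral>\<^sup>+x. f x \<partial>lborel) = (\<integral>\<^sup>+x. f x \<partial>distr lborel borel ((+) c))"
    by (simp only: lborel_distr_plus)
  also have "\<dots> = (\<integral>\<^sup>+x. f (c + x) \<partial>lborel)"
    by (subst nn_integral_distr) auto
  finally show ?thesis ..
qed

lemma nn_integral_lborel_reflect:
  fixes f :: "'a::euclidean_space \<Rightarrow> ennreal"
  assumes [measurable]: "f \<in> borel_measurable borel"
  shows "(\<integral>\<^sup>+x. f (c - x) \<partial>lborel) = (\<integral>\<^sup>+x. f x \<partial>lborel)"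
proof -
  have "(\<integral>\<^sup>+x. f x \<partial>lborel) = (\<integral>\<^sup>+x. f x \<partial>density (distr lborel borel (\<lambda>x. c + (-1) *\<^sub>R x)) (\<lambda>_. 1))"
    using lborel_affine[of "-1" c] by simp
  also have "\<dots> = (\<integral>\<^sup>+x. f (c - x) \<partial>lborel)"
    by (simp add: density_1 nn_integral_distr)
  finally show ?thesis ..
qed

text \<open>Formulated on \<open>lborel\<close>, where it can be checked on Borel functions by
  iterated integrals; null sets and Lebesgue measurable functions are then reached through the
  completion.\<close>

definition preserves_lborel :: "('a::euclidean_space \<Rightarrow> 'b::euclidean_space) \<Rightarrow> bool" where
  "preserves_lborel T \<longleftrightarrow> T \<in> borel_measurable borel \<and> distr lborel lborel T = lborel"

lemma preserves_lborelI:
  fixes T :: "'a::euclidean_space \<Rightarrow> 'b::euclidean_space"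
  assumes [measurable]: "T \<in> borel_measurable borel"
    and "\<And>f :: 'b \<Rightarrow> ennreal. f \<in> borel_measurable borel \<Longrightarrow>
           (\<integral>\<^sup>+x. f (T x) \<partial>lborel) = (\<integral>\<^sup>+x. f x \<partial>lborel)"
  shows "preserves_lborel T"
  unfolding preserves_lborel_def
proof (intro conjI measure_eqI)
  fix A assume "A \<in> sets (distr lborel lborel T)"
  then have A[measurable]: "A \<in> sets borel" by simp
  have "emeasure (distr lborel lborel T) A = (\<integral>\<^sup>+x. indicator A x \<partial>distr lborel lborel T)"
    by simp
  also have "\<dots> = (\<integral>\<^sup>+x. indicator A (T x) \<partial>lborel)"
    by (subst nn_integral_distr) auto
  also have "\<dots> = emeasure lborel A"
    by (subst assms(2)) auto
  finally show "emeasure (distr lborel lborel T) A = emeasure lborel A" .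
qed auto

lemma preserves_lborel_AE:
  fixes T :: "'a::euclidean_space \<Rightarrow> 'b::euclidean_space"
  assumes "preserves_lborel T" "AE x in lborel. P x"
  shows "AE x in lborel. P (T x)"
proof (rule AE_distrD[of T lborel lborel])
  show "T \<in> lborel \<rightarrow>\<^sub>M lborel"
    using assms(1) by (simp add: preserves_lborel_def)
  show "AE x in distr lborel lborel T. P x"
    using assms by (metis preserves_lborel_def)
qed

text \<open>Composing a Lebesgue measurable function with a Borel map can destroy measurability.
  Here it does not, because preimages of null sets under \<open>T\<close> are null.\<close>

lemma preserves_lborel_measurable:
  fixes T :: "'a::euclidean_space \<Rightarrow> 'b::euclidean_space"
  assumes T: "preserves_lborel T" and f: "f \<in> borel_measurable lebesgue"
  shows "(\<lambda>x. f (T x)) \<in> borel_measurable lebesgue"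
proof -
  have m: "T \<in> measurable lborel lborel" and d: "distr lborel lborel T = lborel"
    using T by (auto simp: preserves_lborel_def)
  have "T \<in> measurable lebesgue lebesgue"
  proof (rule completion.measurable_completion2)
    show "T \<in> lebesgue \<rightarrow>\<^sub>M lborel"
      using m by (rule measurable_completion)
    show "null_sets lborel \<subseteq> null_sets (distr lebesgue lborel T)"
      unfolding distr_completion[OF m] d ..
  qed
  from measurable_compose[OF this f] show ?thesis .
qed

lemma preserves_lborel_nn_integral:
  assumes T: "preserves_lborel T" and f: "(f :: _ \<Rightarrow> ennreal) \<in> borel_measurable lebesgue"
  shows "(\<integral>\<^sup>+x. f (T x) \<partial>lborel) = (\<integral>\<^sup>+x. f x \<partial>lborel)"
proof -
  obtain g where g[measurable]: "g \<in> borel_measurable borel" and ae: "AE x in lborel. f x = g x"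
    using completion_ex_borel_measurable[OF f] by auto
  have [measurable]: "T \<in> borel_measurable borel" and d: "distr lborel lborel T = lborel"
    using T by (auto simp: preserves_lborel_def)
  have "(\<integral>\<^sup>+x. f (T x) \<partial>lborel) = (\<integral>\<^sup>+x. g (T x) \<partial>lborel)"
    by (intro nn_integral_cong_AE preserves_lborel_AE[OF T ae])
  also have "\<dots> = (\<integral>\<^sup>+x. g x \<partial>distr lborel lborel T)"
    by (subst nn_integral_distr) auto
  also have "\<dots> = (\<integral>\<^sup>+x. f x \<partial>lborel)"
    unfolding d using ae by (intro nn_integral_cong_AE) auto
  finally show ?thesis .
qed

text \<open>Composition with this map puts a space-time function into the frame moving with free
  particles. The phase point is grouped apart from the time, so that Fubini sections of the
  composition are functions of time along one trajectory.\<close>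

definition stream :: "('a::euclidean_space \<times> 'a) \<times> real \<Rightarrow> 'a \<times> 'a \<times> real" where
  "stream = (\<lambda>((v, x), t). (v, x + t *\<^sub>R v, t))"

lemma stream_measurable [measurable]: "stream \<in> borel_measurable borel"
  unfolding stream_def case_prod_beta' by (intro borel_measurable_continuous_onI continuous_intros)

text \<open>At fixed v and t the map translates x by t v. The two exchanges of the x and t integrals
  only bring the x integral innermost and back.\<close>

lemma preserves_lborel_stream: "preserves_lborel (stream :: ('a::euclidean_space \<times> 'a) \<times> real \<Rightarrow> _)"
proof (rule preserves_lborelI)
  fix f :: "'a \<times> 'a \<times> real \<Rightarrow> ennreal" assume [measurable]: "f \<in> borel_measurable borel"
  have "(\<integral>\<^sup>+x. f (stream x) \<partial>lborel) = (\<integral>\<^sup>+p. (\<integral>\<^sup>+t. f (stream (p, t)) \<partial>lborel) \<partial>lborel)"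
    by (rule nn_integral_lborel_pair) measurable
  also have "\<dots> = (\<integral>\<^sup>+v. (\<integral>\<^sup>+x. (\<integral>\<^sup>+t. f (stream ((v, x), t)) \<partial>lborel) \<partial>lborel) \<partial>lborel)"
    by (rule nn_integral_lborel_pair) measurable
  also have "\<dots> = (\<integral>\<^sup>+v. (\<integral>\<^sup>+t. (\<integral>\<^sup>+x. f (v, t *\<^sub>R v + x, t) \<partial>lborel) \<partial>lborel) \<partial>lborel)"
  proof (rule nn_integral_cong)
    fix v :: 'a
    have "(\<lambda>(x, t). f (v, x + t *\<^sub>R v, t)) \<in> borel_measurable borel"
      unfolding case_prod_beta'
      by (intro borel_measurable_comp_continuous[OF \<open>f \<in> borel_measurable borel\<close>] continuous_intros)
    from nn_integral_lborel_swap[OF this]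
    show "(\<integral>\<^sup>+x. (\<integral>\<^sup>+t. f (stream ((v, x), t)) \<partial>lborel) \<partial>lborel)
        = (\<integral>\<^sup>+t. (\<integral>\<^sup>+x. f (v, t *\<^sub>R v + x, t) \<partial>lborel) \<partial>lborel)"
      by (simp add: stream_def add.commute)
  qed
  also have "\<dots> = (\<integral>\<^sup>+v. (\<integral>\<^sup>+t. (\<integral>\<^sup>+x. f (v, x, t) \<partial>lborel) \<partial>lborel) \<partial>lborel)"
    by (rule nn_integral_cong, rule nn_integral_cong, rule nn_integral_lborel_translate) simp
  also have "\<dots> = (\<integral>\<^sup>+v. (\<integral>\<^sup>+x. (\<integral>\<^sup>+t. f (v, x, t) \<partial>lborel) \<partial>lborel) \<partial>lborel)"
  proof (rule nn_integral_cong)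
    fix v :: 'a
    have "(\<lambda>(x, t). f (v, x, t)) \<in> borel_measurable borel"
      unfolding case_prod_beta'
      by (intro borel_measurable_comp_continuous[OF \<open>f \<in> borel_measurable borel\<close>] continuous_intros)
    from nn_integral_lborel_swap[OF this]
    show "(\<integral>\<^sup>+t. (\<integral>\<^sup>+x. f (v, x, t) \<partial>lborel) \<partial>lborel)
        = (\<integral>\<^sup>+x. (\<integral>\<^sup>+t. f (v, x, t) \<partial>lborel) \<partial>lborel)"
      by simp
  qed
  also have "\<dots> = (\<integral>\<^sup>+v. (\<integral>\<^sup>+p. f (v, p) \<partial>lborel) \<partial>lborel)"
    by (intro nn_integral_cong, subst nn_integral_lborel_pair) simp_all
  also have "\<dots> = (\<integral>\<^sup>+x. f x \<partial>lborel)"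
    by (subst nn_integral_lborel_pair) simp_all
  finally show "(\<integral>\<^sup>+x. f (stream x) \<partial>lborel) = (\<integral>\<^sup>+x. f x \<partial>lborel)" .
qed simp

lemma shear_measurable [measurable]:
  "(\<lambda>(v, x). (v, x + t *\<^sub>R v :: 'a::euclidean_space)) \<in> borel_measurable borel"
  unfolding case_prod_beta' by (intro borel_measurable_continuous_onI continuous_intros)

lemma preserves_lborel_shear:
  "preserves_lborel (\<lambda>(v, x). (v, x + t *\<^sub>R v :: 'a::euclidean_space))"
proof (rule preserves_lborelI)
  fix f :: "'a \<times> 'a \<Rightarrow> ennreal" assume [measurable]: "f \<in> borel_measurable borel"
  have "(\<lambda>p. f (case p of (v, x) \<Rightarrow> (v, x + t *\<^sub>R v))) \<in> borel_measurable borel"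
    by (rule measurable_compose[OF shear_measurable]) fact
  then have "(\<integral>\<^sup>+p. f (case p of (v, x) \<Rightarrow> (v, x + t *\<^sub>R v)) \<partial>lborel)
      = (\<integral>\<^sup>+v. (\<integral>\<^sup>+x. f (v, t *\<^sub>R v + x) \<partial>lborel) \<partial>lborel)"
    by (subst nn_integral_lborel_pair) (simp_all add: add.commute)
  also have "\<dots> = (\<integral>\<^sup>+v. (\<integral>\<^sup>+x. f (v, x) \<partial>lborel) \<partial>lborel)"
    by (rule nn_integral_cong, rule nn_integral_lborel_translate) simp
  also have "\<dots> = (\<integral>\<^sup>+p. f p \<partial>lborel)"
    by (subst nn_integral_lborel_pair) simp_all
  finally show "(\<integral>\<^sup>+p. f (case p of (v, x) \<Rightarrow> (v, x + t *\<^sub>R v)) \<partial>lborel) = (\<integral>\<^sup>+p. f p \<partial>lborel)" .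
qed (rule shear_measurable)

lemma L1_norm_transport:
  fixes \<phi> :: "(real ^ 'n) \<times> (real ^ 'n) \<Rightarrow> real"
  assumes "\<phi> \<in> borel_measurable lebesgue"
  shows "L1_norm (transport t \<phi>) = L1_norm \<phi>"
proof -
  have "(\<lambda>p. ennreal \<bar>\<phi> p\<bar>) \<in> borel_measurable lebesgue"
    using assms by measurable
  from preserves_lborel_nn_integral[OF preserves_lborel_shear this, of t]
  show ?thesis
    by (simp add: L1_norm_def transport_def case_prod_beta' nn_integral_completion)
qed

section \<open>Integrals of Gaussians\<close>

lemma ex_dyadic_shell:
  fixes s :: real
  assumes "1 \<le> s"
  shows "\<exists>j::nat. 2 ^ j \<le> s \<and> s < 2 ^ Suc j"
proof -
  obtain n where "s < 2 ^ n" using real_arch_pow[of 2 s] by auto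
  then have ex: "\<exists>n. s < 2 ^ n" ..
  define n where "n = (LEAST n. s < 2 ^ n)"
  have n: "s < 2 ^ n" unfolding n_def using ex by (rule LeastI_ex)
  then have "n \<noteq> 0" using assms by (auto intro!: gr0I)
  then obtain j where j: "n = Suc j" by (cases n) auto
  have "\<not> s < 2 ^ j"
    using not_less_Least[of j "\<lambda>n. s < 2 ^ n"] j unfolding n_def by simp
  with n j show ?thesis by (intro exI[of _ j]) auto
qed

lemma power_over_fact_le_exp:
  fixes x :: real
  assumes "0 \<le> x"
  shows "x ^ n / fact n \<le> exp x"
proof -
  have "(\<Sum>k\<in>{n}. x ^ k /\<^sub>R fact k) \<le> (\<Sum>k. x ^ k /\<^sub>R fact k)"
    using assms by (intro sum_le_suminf summable_exp_generic) auto
  then show ?thesis by (simp add: exp_def field_simps)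
qed

text \<open>\<open>f\<close> is dominated by the sum of the constants \<open>a j\<close> on the
  balls of radius \<open>r j\<close>. Overlaps are harmless for an upper bound, and summability of
  volumes times heights takes the place of polar coordinates.\<close>

lemma nn_integral_dyadic_finite:
  fixes a r :: "nat \<Rightarrow> real" and f :: "'a::euclidean_space \<Rightarrow> ennreal"
  assumes "\<And>j. 0 \<le> a j" "\<And>j. 0 \<le> r j"
    and sm: "summable (\<lambda>j. a j * r j ^ DIM('a))"
    and le: "\<And>z. f z \<noteq> 0 \<Longrightarrow> \<exists>j. norm z \<le> r j \<and> f z \<le> ennreal (a j)"
  shows "(\<integral>\<^sup>+z. f z \<partial>lborel) < \<infinity>"
proof -
  let ?g = "\<lambda>j z. ennreal (a j) * indicator (cball 0 (r j)) (z::'a)"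
  have "f z \<le> (\<Sum>j. ?g j z)" for z
  proof (cases "f z = 0")
    case False
    from le[OF this] obtain j where "norm z \<le> r j" "f z \<le> ennreal (a j)" by auto
    then have "f z \<le> (\<Sum>i\<in>{j}. ?g i z)" by simp
    also have "\<dots> \<le> (\<Sum>i. ?g i z)" by (rule sum_le_suminf) auto
    finally show ?thesis .
  qed simp
  then have "(\<integral>\<^sup>+z. f z \<partial>lborel) \<le> (\<integral>\<^sup>+z. (\<Sum>j. ?g j z) \<partial>lborel)"
    by (intro nn_integral_mono) auto
  also have "\<dots> = (\<Sum>j. \<integral>\<^sup>+z. ?g j z \<partial>lborel)"
    by (rule nn_integral_suminf) (intro borel_measurable_times_ennreal borel_measurable_indicator, auto)
  also have "\<dots> = (\<Sum>j. ennreal (a j * (unit_ball_vol (real DIM('a)) * r j ^ DIM('a))))"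
    using assms by (intro suminf_cong) (simp add: nn_integral_cmult_indicator emeasure_cball ennreal_mult)
  also have "\<dots> < \<infinity>"
  proof -
    have "summable (\<lambda>j. unit_ball_vol (real DIM('a)) * (a j * r j ^ DIM('a)))"
      using sm by (rule summable_mult)
    then have "summable (\<lambda>j. a j * (unit_ball_vol (real DIM('a)) * r j ^ DIM('a)))"
      by (simp add: mult_ac)
    then show ?thesis
      using assms by (subst suminf_ennreal2) (auto intro!: mult_nonneg_nonneg)
  qed
  finally show ?thesis .
qed

text \<open>A single term of the exponential series at \<delta> s^2 suffices, with index n at least
  \<gamma> + m; it yields the constant \<open>fact n / \<delta> ^ n\<close>. Since s \<ge> 1, powers
  of s may be raised to powers of s^2.\<close>

lemma powr_gauss_decay:
  fixes \<gamma> \<delta> :: real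
  assumes "0 < \<delta>"
  obtains C where "0 \<le> C" "\<And>s. 1 \<le> s \<Longrightarrow> s powr \<gamma> * exp (- \<delta> * s\<^sup>2) \<le> C / s ^ m"
proof -
  obtain n :: nat where n: "\<gamma> + real m \<le> real n" using real_arch_simple by blast
  show thesis
  proof (rule that)
    show "0 \<le> fact n / \<delta> ^ n" using assms by simp
    fix s :: real assume s: "1 \<le> s"
    have "s powr \<gamma> * s ^ m = s powr (\<gamma> + real m)"
      using s by (simp add: powr_add powr_realpow)
    also have "\<dots> \<le> s powr real n" using s n by (intro powr_mono) auto
    also have "\<dots> = s ^ n" using s by (simp add: powr_realpow)
    also have "\<dots> \<le> (s\<^sup>2) ^ n"
      using s by (intro power_mono) (auto simp: power2_eq_square)
    also have "\<dots> = fact n / \<delta> ^ n * ((\<delta> * s\<^sup>2) ^ n / fact n)"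
      using assms by (simp add: power_mult_distrib)
    also have "\<dots> \<le> fact n / \<delta> ^ n * exp (\<delta> * s\<^sup>2)"
      using assms by (intro mult_left_mono power_over_fact_le_exp) auto
    finally have "s powr \<gamma> * s ^ m \<le> fact n / \<delta> ^ n * exp (\<delta> * s\<^sup>2)" .
    then have "s powr \<gamma> \<le> fact n / \<delta> ^ n * exp (\<delta> * s\<^sup>2) / s ^ m"
      using s by (simp only: pos_le_divide_eq zero_less_power)
    then have "s powr \<gamma> * exp (- \<delta> * s\<^sup>2)
        \<le> fact n / \<delta> ^ n * exp (\<delta> * s\<^sup>2) / s ^ m * exp (- \<delta> * s\<^sup>2)"
      by (rule mult_right_mono) simp
    also have "\<dots> = fact n / \<delta> ^ n / s ^ m"
      by (simp add: exp_minus)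
    finally show "s powr \<gamma> * exp (- \<delta> * s\<^sup>2) \<le> fact n / \<delta> ^ n / s ^ m" .
  qed
qed

text \<open>Inside the unit ball the shells form a geometric series of ratio 2 to the power
  -(\<gamma> + D), which is below 1 exactly because \<gamma> > -D. Outside, decay of order D + 1
  beats the growth of the ball volumes and leaves the ratio 1/2.\<close>

lemma nn_integral_powr_gauss_finite:
  fixes \<gamma> \<delta> :: real
  assumes \<gamma>: "- real DIM('a) < \<gamma>" and \<delta>: "0 < \<delta>"
  shows "(\<integral>\<^sup>+z. ennreal (norm z powr \<gamma> * exp (- \<delta> * (norm z)\<^sup>2)) \<partial>(lborel :: 'a::euclidean_space measure)) < \<infinity>"
proof -
  let ?D = "DIM('a)"
  let ?f = "\<lambda>z::'a. ennreal (norm z powr \<gamma> * exp (- \<delta> * (norm z)\<^sup>2))"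
  let ?i = "indicator (cball 0 1) :: 'a \<Rightarrow> ennreal" and ?o = "indicator (- cball 0 1) :: 'a \<Rightarrow> ennreal"
  have inner: "(\<integral>\<^sup>+z. ?f z * ?i z \<partial>lborel) < \<infinity>"
  proof (rule nn_integral_dyadic_finite)
    \<comment> \<open>On the j-th shell \<open>norm z\<close> lies between \<open>?r j / 2\<close>
      and \<open>?r j\<close>. The factor \<open>2 powr \<bar>\<gamma>\<bar>\<close> lets one height
      serve both signs of \<gamma>: for negative \<gamma> the power is largest at the inner
      radius.\<close>
    let ?a = "\<lambda>j::nat. 2 powr \<bar>\<gamma>\<bar> * (1 / 2 ^ j) powr \<gamma>" and ?r = "\<lambda>j::nat. 1 / 2 ^ j :: real"
    show "0 \<le> ?a j" "0 \<le> ?r j" for j by auto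
    have "?a j * ?r j ^ ?D = 2 powr \<bar>\<gamma>\<bar> * (2 powr (- (\<gamma> + ?D))) ^ j" for j
    proof -
      have "?r j = 2 powr (- real j)" by (simp add: powr_minus powr_realpow divide_inverse)
      then have "?r j powr \<gamma> * ?r j ^ ?D = 2 powr (- real j * \<gamma>) * 2 powr (- real j * real ?D)"
        by (simp add: powr_powr powr_realpow[symmetric])
      also have "\<dots> = 2 powr (- (\<gamma> + ?D) * real j)"
        by (simp add: powr_add[symmetric] algebra_simps)
      also have "\<dots> = (2 powr (- (\<gamma> + ?D))) ^ j"
        by (simp add: powr_powr[symmetric] powr_realpow)
      finally show ?thesis by simp
    qed
    moreover have "summable (\<lambda>j. (2 powr (- (\<gamma> + ?D))) ^ j)"
      using \<gamma> powr_less_mono[of "- (\<gamma> + ?D)" 0 2] by (intro summable_geometric) simp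
    ultimately show "summable (\<lambda>j. ?a j * ?r j ^ ?D)"
      by (simp only: summable_mult)
    fix z :: 'a assume "?f z * ?i z \<noteq> 0"
    then have z: "0 < norm z" "norm z \<le> 1" by (auto split: split_indicator_asm)
    then obtain j :: nat where j: "2 ^ j \<le> 1 / norm z" "1 / norm z < 2 ^ Suc j"
      using ex_dyadic_shell[of "1 / norm z"] by auto
    have zr: "norm z \<le> ?r j" "?r j \<le> 2 * norm z"
      using j z by (auto simp: field_simps)
    have "norm z powr \<gamma> \<le> ?a j"
    proof (cases "0 \<le> \<gamma>")
      case True
      have "norm z powr \<gamma> \<le> ?r j powr \<gamma>" using z zr True by (intro powr_mono2) auto
      also have "\<dots> \<le> ?a j" using ge_one_powr_ge_zero[of 2 "\<bar>\<gamma>\<bar>"] by (simp add: mult_le_cancel_right1)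
      finally show ?thesis .
    next
      case False
      have "norm z powr \<gamma> \<le> (?r j / 2) powr \<gamma>" using z zr False by (intro powr_mono2') auto
      also have "\<dots> = ?a j" using False by (simp add: powr_divide powr_minus_divide powr_mult)
      finally show ?thesis .
    qed
    moreover have "norm z powr \<gamma> * exp (- \<delta> * (norm z)\<^sup>2) \<le> norm z powr \<gamma>"
      using \<delta> by (intro mult_left_le) auto
    ultimately have "norm z powr \<gamma> * exp (- \<delta> * (norm z)\<^sup>2) \<le> ?a j" by (rule order_trans[rotated])
    then have "?f z * ?i z \<le> ennreal (?a j)"
      using z by (simp only: indicator_simps mem_cball_0 mult_1_right ennreal_leI)
    with zr show "\<exists>j. norm z \<le> ?r j \<and> ?f z * ?i z \<le> ennreal (?a j)" by blast
  qed
  obtain C where C: "0 \<le> C" "\<And>s. 1 \<le> s \<Longrightarrow> s powr \<gamma> * exp (- \<delta> * s\<^sup>2) \<le> C / s ^ (?D + 1)"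
    using powr_gauss_decay[OF \<delta>] by metis
  have outer: "(\<integral>\<^sup>+z. ?f z * ?o z \<partial>lborel) < \<infinity>"
  proof (rule nn_integral_dyadic_finite)
    let ?a = "\<lambda>j::nat. C / (2 ^ j) ^ (?D + 1)" and ?r = "\<lambda>j::nat. 2 ^ Suc j :: real"
    show "0 \<le> ?a j" "0 \<le> ?r j" for j using C by auto
    have "?a j * ?r j ^ ?D = C * 2 ^ ?D * (1 / 2) ^ j" for j
      by (simp add: power_mult_distrib field_simps)
    then show "summable (\<lambda>j. ?a j * ?r j ^ ?D)"
      by (simp add: summable_mult summable_geometric del: power_Suc)
    fix z :: 'a assume "?f z * ?o z \<noteq> 0"
    then have z: "1 \<le> norm z" by (auto split: split_indicator_asm)
    then obtain j :: nat where j: "2 ^ j \<le> norm z" "norm z < 2 ^ Suc j"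
      using ex_dyadic_shell by blast
    have "?f z * ?o z \<le> ennreal (C / norm z ^ (?D + 1))"
      using C(2)[OF z] by (auto simp: ennreal_leI split: split_indicator)
    also have "\<dots> \<le> ennreal (?a j)"
      using j C(1) by (intro ennreal_leI frac_le power_mono zero_less_power) auto
    finally show "\<exists>j. norm z \<le> ?r j \<and> ?f z * ?o z \<le> ennreal (?a j)"
      using j by (intro exI[of _ j]) auto
  qed
  have "(\<integral>\<^sup>+z. ?f z \<partial>lborel) = (\<integral>\<^sup>+z. ?f z * ?i z + ?f z * ?o z \<partial>lborel)"
    by (intro nn_integral_cong) (auto split: split_indicator)
  also have "\<dots> = (\<integral>\<^sup>+z. ?f z * ?i z \<partial>lborel) + (\<integral>\<^sup>+z. ?f z * ?o z \<partial>lborel)"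
  proof (rule nn_integral_add)
    have [measurable]: "cball (0::'a) 1 \<in> sets borel" by auto
    show "(\<lambda>z. ?f z * ?i z) \<in> borel_measurable lborel" by measurable
    show "(\<lambda>z. ?f z * ?o z) \<in> borel_measurable lborel" by measurable
  qed
  also have "\<dots> < \<infinity>" using inner outer by simp
  finally show ?thesis .
qed

lemma nn_integral_gauss_finite:
  fixes \<delta> :: real
  assumes "0 < \<delta>"
  shows "(\<integral>\<^sup>+z. ennreal (exp (- \<delta> * (norm z)\<^sup>2)) \<partial>(lborel :: 'a::euclidean_space measure)) < \<infinity>"
proof -
  have "(\<integral>\<^sup>+z. ennreal (exp (- \<delta> * (norm z)\<^sup>2)) \<partial>(lborel :: 'a measure))
      = (\<integral>\<^sup>+z. ennreal (norm z powr 0 * exp (- \<delta> * (norm z)\<^sup>2)) \<partial>(lborel :: 'a measure))"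
    \<comment> \<open>\<open>0 powr 0\<close> is \<open>0\<close>, so the two integrands differ at
      the origin.\<close>
    by (intro nn_integral_cong_AE eventually_mono[OF AE_lborel_singleton[of 0]]) auto
  also have "\<dots> < \<infinity>"
    by (rule nn_integral_powr_gauss_finite) (use assms in auto)
  finally show ?thesis .
qed

section \<open>Two Gaussians streaming with different velocities\<close>

lemma borel_measurable_nn_integral_lborel:
  fixes f :: "'a::euclidean_space \<Rightarrow> 'b::euclidean_space \<Rightarrow> ennreal"
  assumes "(\<lambda>(x, y). f x y) \<in> borel_measurable borel"
  shows "(\<lambda>x. \<integral>\<^sup>+y. f x y \<partial>lborel) \<in> borel_measurable borel"
proof -
  have s: "sets (borel \<Otimes>\<^sub>M (lborel :: 'b measure)) = sets (borel :: ('a \<times> 'b) measure)"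
    unfolding borel_prod[symmetric] by (rule sets_pair_measure_cong) simp_all
  have "(\<lambda>(x, y). f x y) \<in> borel_measurable (borel \<Otimes>\<^sub>M lborel)"
    unfolding measurable_cong_sets[OF s refl] by (rule assms)
  from lborel.borel_measurable_nn_integral[OF this] show ?thesis by simp
qed

text \<open>The order v, w, t, x puts the x integral innermost and the time integral next, both at
  fixed relative velocity; only then can time integration gain a power of |v - w|.\<close>

lemma nn_integral_phase_rearrange:
  fixes f :: "'a::euclidean_space \<times> 'a \<times> real \<Rightarrow> 'a \<Rightarrow> ennreal"
  assumes f: "(\<lambda>(p, w). f p w) \<in> borel_measurable borel"
  shows "(\<integral>\<^sup>+p. (\<integral>\<^sup>+w. f p w \<partial>lborel) \<partial>lborel)
    = (\<integral>\<^sup>+v. (\<integral>\<^sup>+w. (\<integral>\<^sup>+t. (\<integral>\<^sup>+x. f (v, x, t) w \<partial>lborel) \<partial>lborel) \<partial>lborel) \<partial>lborel)"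
proof -
  have f': "(\<lambda>r. f (fst (g r)) (snd (g r))) \<in> borel_measurable borel" if "continuous_on UNIV g" for g
    using borel_measurable_comp_continuous[OF f that] by (simp add: case_prod_beta')
  have "(\<integral>\<^sup>+p. (\<integral>\<^sup>+w. f p w \<partial>lborel) \<partial>lborel) = (\<integral>\<^sup>+v. (\<integral>\<^sup>+q. (\<integral>\<^sup>+w. f (v, q) w \<partial>lborel) \<partial>lborel) \<partial>lborel)"
    by (intro nn_integral_lborel_pair borel_measurable_nn_integral_lborel f)
  also have "\<dots> = (\<integral>\<^sup>+v. (\<integral>\<^sup>+w. (\<integral>\<^sup>+q. f (v, q) w \<partial>lborel) \<partial>lborel) \<partial>lborel)"
  proof (rule nn_integral_cong)
    fix v :: 'a
    have "(\<lambda>(q, w). f (v, q) w) \<in> borel_measurable borel"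
      using f'[of "\<lambda>r. ((v, fst r), snd r)"] by (simp add: case_prod_beta' continuous_intros)
    then show "(\<integral>\<^sup>+q. (\<integral>\<^sup>+w. f (v, q) w \<partial>lborel) \<partial>lborel) = (\<integral>\<^sup>+w. (\<integral>\<^sup>+q. f (v, q) w \<partial>lborel) \<partial>lborel)"
      by (rule nn_integral_lborel_swap)
  qed
  also have "\<dots> = (\<integral>\<^sup>+v. (\<integral>\<^sup>+w. (\<integral>\<^sup>+t. (\<integral>\<^sup>+x. f (v, x, t) w \<partial>lborel) \<partial>lborel) \<partial>lborel) \<partial>lborel)"
  proof (rule nn_integral_cong, rule nn_integral_cong)
    fix v w :: 'a
    have m: "(\<lambda>q. f (v, q) w) \<in> borel_measurable borel"
      using f'[of "\<lambda>q. ((v, q), w)"] by (simp add: continuous_intros)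
    then have "(\<integral>\<^sup>+q. f (v, q) w \<partial>lborel) = (\<integral>\<^sup>+x. (\<integral>\<^sup>+t. f (v, x, t) w \<partial>lborel) \<partial>lborel)"
      by (rule nn_integral_lborel_pair)
    also have "\<dots> = (\<integral>\<^sup>+t. (\<integral>\<^sup>+x. f (v, x, t) w \<partial>lborel) \<partial>lborel)"
      by (rule nn_integral_lborel_swap) (use m in \<open>simp add: case_prod_beta'\<close>)
    finally show "(\<integral>\<^sup>+q. f (v, q) w \<partial>lborel) = (\<integral>\<^sup>+t. (\<integral>\<^sup>+x. f (v, x, t) w \<partial>lborel) \<partial>lborel)" .
  qed
  finally show ?thesis .
qed

text \<open>The right-hand side has one factor for each integration to come: over v, w, t and x. The
  position terms give the last two by the parallelogram identity. The velocity terms give the first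
  two, because |V|^2 + |W|^2 exceeds |V|^2/2 + |V - W|^2/4 by |V + W|^2/4 + |W|^2/2; this keeps
  decay in V - W after the time Gaussian has been integrated out.\<close>

lemma streaming_gauss_pair_le:
  fixes V W X :: "'a::real_inner" and \<delta> t :: real
  assumes "0 < \<delta>"
  shows "exp (- \<delta> * ((norm V)\<^sup>2 + (norm (X - t *\<^sub>R V))\<^sup>2)) * exp (- \<delta> * ((norm W)\<^sup>2 + (norm (X - t *\<^sub>R W))\<^sup>2))
    \<le> exp (- (\<delta> / 2) * (norm V)\<^sup>2) * exp (- (\<delta> / 4) * (norm (V - W))\<^sup>2)
      * exp (- (\<delta> / 2) * (norm (V - W) * t)\<^sup>2) * exp (- (2 * \<delta>) * (norm (X - (t / 2) *\<^sub>R (V + W)))\<^sup>2)"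
proof -
  have 1: "(norm (X - t *\<^sub>R V))\<^sup>2 + (norm (X - t *\<^sub>R W))\<^sup>2
      = 2 * (norm (X - (t / 2) *\<^sub>R (V + W)))\<^sup>2 + (norm (V - W) * t)\<^sup>2 / 2"
    unfolding power_mult_distrib power2_norm_eq_inner
    by (simp add: inner_add_left inner_add_right inner_diff_left inner_diff_right inner_commute
        field_simps power2_eq_square)
  have "0 \<le> (norm (V + W))\<^sup>2 / 4 + (norm W)\<^sup>2 / 2" by simp
  also have "\<dots> = (norm V)\<^sup>2 + (norm W)\<^sup>2 - ((norm V)\<^sup>2 / 2 + (norm (V - W))\<^sup>2 / 4)"
    unfolding power2_norm_eq_inner
    by (simp add: inner_add_left inner_add_right inner_diff_left inner_diff_right inner_commute field_simps)
  finally have 2: "(norm V)\<^sup>2 / 2 + (norm (V - W))\<^sup>2 / 4 \<le> (norm V)\<^sup>2 + (norm W)\<^sup>2" by simp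
  have "\<delta> * ((norm V)\<^sup>2 / 2 + (norm (V - W))\<^sup>2 / 4 + (norm (V - W) * t)\<^sup>2 / 2
        + 2 * (norm (X - (t / 2) *\<^sub>R (V + W)))\<^sup>2)
      \<le> \<delta> * (((norm V)\<^sup>2 + (norm W)\<^sup>2) + ((norm (X - t *\<^sub>R V))\<^sup>2 + (norm (X - t *\<^sub>R W))\<^sup>2))"
    unfolding 1 using 2 assms by (intro mult_left_mono) auto
  then show ?thesis
    unfolding exp_add[symmetric] exp_le_cancel_iff by (simp add: algebra_simps)
qed

text \<open>Integrating in time first turns \<open>|v - w|\<^sup>\<beta>\<close> into \<open>|v - w|\<^bsup>\<beta>-1\<^esup>\<close>, which is locally integrable
  exactly when \<open>\<beta> > 1 - D\<close>.\<close>

lemma streaming_gauss_pair_integral_finite: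
  fixes v0 x0 :: "'a::euclidean_space" and \<delta> \<beta> :: real
  assumes \<delta>: "0 < \<delta>" and \<beta>: "1 - real DIM('a) < \<beta>"
  defines "E \<equiv> \<lambda>(v, x, t). exp (- \<delta> * ((norm (v - v0))\<^sup>2 + (norm (x - x0 - t *\<^sub>R (v - v0)))\<^sup>2))"
  shows "(\<lambda>((v, x, t), w). ennreal (E (v, x, t) * E (w, x, t) * norm (v - w) powr \<beta>)) \<in> borel_measurable borel"
    and "(\<integral>\<^sup>+(v, x, t). (\<integral>\<^sup>+w. ennreal (E (v, x, t) * E (w, x, t) * norm (v - w) powr \<beta>) \<partial>lborel) \<partial>lborel) < \<infinity>"
proof -
  let ?f = "\<lambda>(v, x, t) w. ennreal (E (v, x, t) * E (w, x, t) * norm (v - w) powr \<beta>)"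
  show m: "(\<lambda>((v, x, t), w). ennreal (E (v, x, t) * E (w, x, t) * norm (v - w) powr \<beta>)) \<in> borel_measurable borel"
    unfolding E_def case_prod_beta' borel_prod[symmetric] by measurable
  have m': "(\<lambda>(p, w). ?f p w) \<in> borel_measurable borel"
    using m by (simp add: case_prod_beta')
  \<comment> \<open>\<open>K1\<close>, \<open>K2\<close>, \<open>K3\<close>, \<open>K4\<close> are
    what the integrals over x, t, w and v contribute, in this order.\<close>
  define K1 where "K1 = (\<integral>\<^sup>+x. ennreal (exp (- (2 * \<delta>) * (norm x)\<^sup>2)) \<partial>(lborel :: 'a measure))"
  define K2 where "K2 = (\<integral>\<^sup>+t. ennreal (exp (- (\<delta> / 2) * (norm t)\<^sup>2)) \<partial>(lborel :: real measure))"
  define K3 where "K3 = (\<integral>\<^sup>+z. ennreal (norm z powr (\<beta> - 1) * exp (- (\<delta> / 4) * (norm z)\<^sup>2)) \<partial>(lborel :: 'a measure))"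
  define K4 where "K4 = (\<integral>\<^sup>+x. ennreal (exp (- (\<delta> / 2) * (norm x)\<^sup>2)) \<partial>(lborel :: 'a measure))"
  have fin: "K1 < \<infinity>" "K2 < \<infinity>" "K3 < \<infinity>" "K4 < \<infinity>"
    unfolding K1_def K2_def K3_def K4_def using \<delta> \<beta>
    by (intro nn_integral_gauss_finite nn_integral_powr_gauss_finite; simp)+
  have x_int: "(\<integral>\<^sup>+x. ?f (v, x, t) w \<partial>lborel)
      \<le> ennreal (exp (- (\<delta> / 2) * (norm (v - v0))\<^sup>2) * (norm (v - w) powr \<beta> * exp (- (\<delta> / 4) * (norm (v - w))\<^sup>2)))
         * ennreal (exp (- (\<delta> / 2) * (norm (v - w) * t)\<^sup>2)) * K1" for v w t
  proof -
    let ?C = "exp (- (\<delta> / 2) * (norm (v - v0))\<^sup>2) * (norm (v - w) powr \<beta> * exp (- (\<delta> / 4) * (norm (v - w))\<^sup>2))"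
    let ?T = "exp (- (\<delta> / 2) * (norm (v - w) * t)\<^sup>2)"
    \<comment> \<open>The midpoint at time \<open>t\<close> of two particles that leave
      \<open>x0\<close> with velocities v - v0 and w - v0: the centre of the Gaussian in x.\<close>
    let ?y = "x0 + (t / 2) *\<^sub>R (v - v0 + (w - v0))"
    have "?f (v, x, t) w \<le> ennreal ?C * ennreal ?T * ennreal (exp (- (2 * \<delta>) * (norm (- ?y + x))\<^sup>2))" for x
    proof -
      have "E (v, x, t) * E (w, x, t) * norm (v - w) powr \<beta>
        \<le> (exp (- (\<delta> / 2) * (norm (v - v0))\<^sup>2) * exp (- (\<delta> / 4) * (norm (v - w))\<^sup>2)
          * ?T * exp (- (2 * \<delta>) * (norm (- ?y + x))\<^sup>2)) * norm (v - w) powr \<beta>"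
        using streaming_gauss_pair_le[OF \<delta>, of "v - v0" "x - x0" t "w - v0"]
        unfolding E_def prod.case
        by (intro mult_right_mono) (simp_all add: algebra_simps)
      then show ?thesis
        by (simp add: ennreal_mult[symmetric] mult_ac ennreal_leI)
    qed
    then have "(\<integral>\<^sup>+x. ?f (v, x, t) w \<partial>lborel)
        \<le> (\<integral>\<^sup>+x. ennreal ?C * ennreal ?T * ennreal (exp (- (2 * \<delta>) * (norm (- ?y + x))\<^sup>2)) \<partial>lborel)"
      by (intro nn_integral_mono) auto
    also have "\<dots> = ennreal ?C * ennreal ?T * (\<integral>\<^sup>+x. ennreal (exp (- (2 * \<delta>) * (norm (- ?y + x))\<^sup>2)) \<partial>lborel)"
      by (rule nn_integral_cmult) measurable
    also have "(\<integral>\<^sup>+x. ennreal (exp (- (2 * \<delta>) * (norm (- ?y + x))\<^sup>2)) \<partial>lborel) = K1"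
      unfolding K1_def by (rule nn_integral_lborel_translate) measurable
    finally show ?thesis .
  qed
  \<comment> \<open>The substitution of r t for t gives equality for r > 0. At r = 0 the time
    integral is infinite, but \<open>0 powr \<beta>\<close> is \<open>0\<close> and annihilates
    it.\<close>
  have t_int: "ennreal (r powr \<beta>) * (\<integral>\<^sup>+t. ennreal (exp (- (\<delta> / 2) * (r * t)\<^sup>2)) \<partial>lborel) \<le> ennreal (r powr (\<beta> - 1)) * K2"
    if "0 \<le> r" for r
  proof (cases "r = 0")
    case False
    then have r: "0 < r" using that by simp
    have "K2 = ennreal r * (\<integral>\<^sup>+t. ennreal (exp (- (\<delta> / 2) * (r * t)\<^sup>2)) \<partial>lborel)"
      unfolding K2_def using r by (subst nn_integral_real_affine[where c=r and t=0]) auto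
    then have "ennreal (r powr (\<beta> - 1)) * K2
        = ennreal (r powr (\<beta> - 1) * r) * (\<integral>\<^sup>+t. ennreal (exp (- (\<delta> / 2) * (r * t)\<^sup>2)) \<partial>lborel)"
      using r by (simp add: ennreal_mult mult.assoc)
    also have "r powr (\<beta> - 1) * r = r powr \<beta>"
      using r by (simp add: powr_diff)
    finally show ?thesis by simp
  qed simp
  have tx_int: "(\<integral>\<^sup>+t. (\<integral>\<^sup>+x. ?f (v, x, t) w \<partial>lborel) \<partial>lborel)
      \<le> ennreal (exp (- (\<delta> / 2) * (norm (v - v0))\<^sup>2)) *
        (ennreal (norm (v - w) powr (\<beta> - 1) * exp (- (\<delta> / 4) * (norm (v - w))\<^sup>2)) * (K1 * K2))" for v w
  proof -
    let ?V = "exp (- (\<delta> / 2) * (norm (v - v0))\<^sup>2)" and ?Z = "exp (- (\<delta> / 4) * (norm (v - w))\<^sup>2)"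
    let ?r = "norm (v - w)"
    let ?I = "\<integral>\<^sup>+t. ennreal (exp (- (\<delta> / 2) * (?r * t)\<^sup>2)) \<partial>lborel"
    have "(\<integral>\<^sup>+t. (\<integral>\<^sup>+x. ?f (v, x, t) w \<partial>lborel) \<partial>lborel)
        \<le> (\<integral>\<^sup>+t. ennreal (?V * (?r powr \<beta> * ?Z)) * ennreal (exp (- (\<delta> / 2) * (?r * t)\<^sup>2)) * K1 \<partial>lborel)"
      by (intro nn_integral_mono x_int)
    also have "\<dots> = ennreal (?V * (?r powr \<beta> * ?Z)) * ?I * K1"
      by (subst nn_integral_multc, measurable) (subst nn_integral_cmult, measurable)
    also have "\<dots> = ennreal ?V * ennreal ?Z * K1 * (ennreal (?r powr \<beta>) * ?I)"
      by (simp add: ennreal_mult mult_ac)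
    also have "\<dots> \<le> ennreal ?V * ennreal ?Z * K1 * (ennreal (?r powr (\<beta> - 1)) * K2)"
      by (intro mult_left_mono t_int) auto
    also have "\<dots> = ennreal ?V * (ennreal (?r powr (\<beta> - 1) * ?Z) * (K1 * K2))"
      by (simp add: ennreal_mult mult_ac)
    finally show ?thesis .
  qed
  have wtx_int: "(\<integral>\<^sup>+w. (\<integral>\<^sup>+t. (\<integral>\<^sup>+x. ?f (v, x, t) w \<partial>lborel) \<partial>lborel) \<partial>lborel)
      \<le> ennreal (exp (- (\<delta> / 2) * (norm (v - v0))\<^sup>2)) * (K3 * (K1 * K2))" for v
  proof -
    let ?V = "ennreal (exp (- (\<delta> / 2) * (norm (v - v0))\<^sup>2))"
    let ?g = "\<lambda>z::'a. ennreal (norm z powr (\<beta> - 1) * exp (- (\<delta> / 4) * (norm z)\<^sup>2))"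
    have "(\<integral>\<^sup>+w. (\<integral>\<^sup>+t. (\<integral>\<^sup>+x. ?f (v, x, t) w \<partial>lborel) \<partial>lborel) \<partial>lborel) \<le> (\<integral>\<^sup>+w. ?V * (?g (v - w) * (K1 * K2)) \<partial>lborel)"
      by (intro nn_integral_mono tx_int)
    also have "\<dots> = ?V * ((\<integral>\<^sup>+w. ?g (v - w) \<partial>lborel) * (K1 * K2))"
      by (subst nn_integral_cmult, measurable) (subst nn_integral_multc, measurable)
    also have "(\<integral>\<^sup>+w. ?g (v - w) \<partial>lborel) = K3"
      unfolding K3_def by (rule nn_integral_lborel_reflect) measurable
    finally show ?thesis .
  qed
  have "(\<integral>\<^sup>+p. (\<integral>\<^sup>+w. ?f p w \<partial>lborel) \<partial>lborel)
    = (\<integral>\<^sup>+v. (\<integral>\<^sup>+w. (\<integral>\<^sup>+t. (\<integral>\<^sup>+x. ?f (v, x, t) w \<partial>lborel) \<partial>lborel) \<partial>lborel) \<partial>lborel)"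
    by (rule nn_integral_phase_rearrange[OF m'])
  also have "\<dots> \<le> (\<integral>\<^sup>+v. ennreal (exp (- (\<delta> / 2) * (norm (- v0 + v))\<^sup>2)) * (K3 * (K1 * K2)) \<partial>lborel)"
    using wtx_int by (intro nn_integral_mono) simp
  also have "\<dots> = (\<integral>\<^sup>+v. ennreal (exp (- (\<delta> / 2) * (norm (- v0 + v))\<^sup>2)) \<partial>lborel) * (K3 * (K1 * K2))"
    by (rule nn_integral_multc) measurable
  also have "(\<integral>\<^sup>+v. ennreal (exp (- (\<delta> / 2) * (norm (- v0 + v))\<^sup>2)) \<partial>lborel) = K4"
    unfolding K4_def by (rule nn_integral_lborel_translate) measurable
  also have "K4 * (K3 * (K1 * K2)) < \<infinity>"
    using fin by (simp add: ennreal_mult_less_top)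
  finally show "(\<integral>\<^sup>+(v, x, t). (\<integral>\<^sup>+w. ennreal (E (v, x, t) * E (w, x, t) * norm (v - w) powr \<beta>) \<partial>lborel) \<partial>lborel) < \<infinity>"
    by (simp add: case_prod_beta')
qed

section \<open>Surface measure and collision kernels\<close>

text \<open>Uniqueness of Haar measure, specialised: both Lebesgue measure and its image under \<open>R\<close> are
  translation invariant, and they agree on the unit ball.\<close>

lemma preserves_lborel_orthogonal:
  fixes R :: "'a::euclidean_space \<Rightarrow> 'a"
  assumes R: "orthogonal_transformation R"
  shows "preserves_lborel R"
proof (rule preserves_lborelI)
  have lin: "linear R" using R by (rule orthogonal_transformation_linear)
  have cR: "continuous_on UNIV R"
    using lin by (simp add: linear_continuous_on linear_conv_bounded_linear)
  then show R_meas[measurable]: "R \<in> borel_measurable borel" by (rule borel_measurable_continuous_onI)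
  fix g :: "'a \<Rightarrow> ennreal" assume g[measurable]: "g \<in> borel_measurable borel"
  obtain R' where R': "\<And>x. R (R' x) = x"
    using orthogonal_transformation_surj[OF R] by (metis surj_def)
  have nR: "norm (x - R y) = norm (R' x - y)" for x y
    using orthogonal_transformation_norm[OF R, of "R' x - y"] by (simp add: linear_diff[OF lin] R')
  \<comment> \<open>The unit ball is invariant under \<open>R\<close> and has positive finite volume
    \<open>?c\<close>, which can be cancelled at the end.\<close>
  define b where "b = (indicator (cball 0 1) :: 'a \<Rightarrow> ennreal)"
  have b[measurable]: "b \<in> borel_measurable borel"
    unfolding b_def by (intro borel_measurable_indicator) auto
  have b_R: "b (x - R y) = b (R' x - y)" for x y
    unfolding b_def by (simp add: indicator_def nR)
  let ?c = "\<integral>\<^sup>+x. b x \<partial>lborel"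
  have c: "?c = emeasure lborel (cball 0 1 :: 'a set)"
    unfolding b_def by (intro nn_integral_indicator) auto
  have c0: "?c \<noteq> 0" "?c \<noteq> \<infinity>"
    unfolding c using unit_ball_vol_pos[of "real DIM('a)"] by (simp_all add: emeasure_cball less_imp_neq[symmetric])
  have m1: "(\<lambda>(x, y). b x * g (x + R y)) \<in> borel_measurable borel"
    unfolding case_prod_beta'
    by (intro borel_measurable_times_ennreal borel_measurable_comp_continuous[OF b]
        borel_measurable_comp_continuous[OF g] continuous_intros continuous_on_compose2[OF cR]) auto
  have m2: "(\<lambda>(y, x). b (x - R y) * g x) \<in> borel_measurable borel"
    unfolding case_prod_beta'
    by (intro borel_measurable_times_ennreal borel_measurable_comp_continuous[OF b]
        borel_measurable_comp_continuous[OF g] continuous_intros continuous_on_compose2[OF cR]) auto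
  have m3: "(\<lambda>(x, y). b x * g (R y + x)) \<in> borel_measurable borel"
    using m1 by (simp add: add.commute)
  \<comment> \<open>The double integral of \<open>b x * g (R y + x)\<close> is computed twice. With
    y innermost, x equals \<open>R (R' x)\<close> and is absorbed by a translation of y, which
    leaves the integral of g after \<open>R\<close>. With x innermost, x is translated by
    \<open>R y\<close>; the y integral then only sees the ball and leaves the integral of g.\<close>
  have "?c * (\<integral>\<^sup>+y. g (R y) \<partial>lborel) = (\<integral>\<^sup>+x. b x * (\<integral>\<^sup>+y. g (R y) \<partial>lborel) \<partial>lborel)"
    by (rule nn_integral_multc[symmetric]) simp
  also have "\<dots> = (\<integral>\<^sup>+x. (\<integral>\<^sup>+y. b x * g (R y + x) \<partial>lborel) \<partial>lborel)"
  proof (rule nn_integral_cong)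
    fix x
    have "(\<integral>\<^sup>+y. g (R y) \<partial>lborel) = (\<integral>\<^sup>+y. g (R (R' x + y)) \<partial>lborel)"
      by (rule nn_integral_lborel_translate[symmetric]) simp
    also have "\<dots> = (\<integral>\<^sup>+y. g (R y + x) \<partial>lborel)"
      by (simp add: linear_add[OF lin] R' add.commute)
    finally show "b x * (\<integral>\<^sup>+y. g (R y) \<partial>lborel) = (\<integral>\<^sup>+y. b x * g (R y + x) \<partial>lborel)"
      by (simp add: nn_integral_cmult)
  qed
  also have "\<dots> = (\<integral>\<^sup>+y. (\<integral>\<^sup>+x. b x * g (R y + x) \<partial>lborel) \<partial>lborel)"
    using m3 by (rule nn_integral_lborel_swap)
  also have "\<dots> = (\<integral>\<^sup>+y. (\<integral>\<^sup>+x. b (x - R y) * g x \<partial>lborel) \<partial>lborel)"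
  proof (rule nn_integral_cong)
    fix y
    show "(\<integral>\<^sup>+x. b x * g (R y + x) \<partial>lborel) = (\<integral>\<^sup>+x. b (x - R y) * g x \<partial>lborel)"
      using nn_integral_lborel_translate[of "\<lambda>x. b (x - R y) * g x" "R y"] by simp
  qed
  also have "\<dots> = (\<integral>\<^sup>+x. (\<integral>\<^sup>+y. b (x - R y) * g x \<partial>lborel) \<partial>lborel)"
    using m2 by (rule nn_integral_lborel_swap)
  also have "\<dots> = (\<integral>\<^sup>+x. ?c * g x \<partial>lborel)"
  proof (rule nn_integral_cong)
    fix x
    have "(\<integral>\<^sup>+y. b (x - R y) * g x \<partial>lborel) = (\<integral>\<^sup>+y. b (R' x - y) \<partial>lborel) * g x"
      unfolding b_R by (rule nn_integral_multc) simp
    then show "(\<integral>\<^sup>+y. b (x - R y) * g x \<partial>lborel) = ?c * g x"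
      by (simp add: nn_integral_lborel_reflect)
  qed
  also have "\<dots> = ?c * (\<integral>\<^sup>+x. g x \<partial>lborel)"
    by (rule nn_integral_cmult) simp
  finally show "(\<integral>\<^sup>+y. g (R y) \<partial>lborel) = (\<integral>\<^sup>+x. g x \<partial>lborel)"
    using c0 by (simp add: ennreal_mult_cancel_left)
qed

section \<open>Finiteness and rotation invariance of the surface measure\<close>

lemma finite_sphere_measure: "finite_measure (sphere_measure :: 'a::euclidean_space measure)"
proof
  have "emeasure sphere_measure (sphere (0::'a) 1)
      = of_nat DIM('a) * emeasure lborel {x \<in> cball (0::'a) 1 - {0}. x /\<^sub>R norm x \<in> sphere 0 1}"
    by (rule emeasure_sphere_measure) auto
  also have "\<dots> \<le> of_nat DIM('a) * emeasure lborel (cball (0::'a) 1)"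
    by (intro mult_left_mono emeasure_mono) auto
  also have "\<dots> < \<infinity>"
    by (simp add: emeasure_cball ennreal_mult_less_top of_nat_less_top)
  finally show "emeasure (sphere_measure :: 'a measure) (space sphere_measure) \<noteq> \<infinity>"
    by (simp add: space_sphere_measure)
qed

lemma borel_measurable_sphere_measure:
  "f \<in> measurable borel N \<Longrightarrow> f \<in> measurable (sphere_measure :: 'a::euclidean_space measure) N"
  unfolding measurable_cong_sets[OF sets_sphere_measure refl] by (rule measurable_restrict_space1)

text \<open>\<open>R\<close> is linear and preserves norms, so it commutes with normalisation: the
  cone over the preimage of A is the preimage of the cone over A. Invariance thus descends from
  Lebesgue measure to the cone measure.\<close>

lemma distr_sphere_measure_orthogonal:
  fixes R :: "'a::euclidean_space \<Rightarrow> 'a"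
  assumes R: "orthogonal_transformation R"
  shows measurable_sphere_measure_orthogonal: "R \<in> measurable sphere_measure sphere_measure"
    and "distr sphere_measure sphere_measure R = sphere_measure"
proof -
  have lin: "linear R" using R by (rule orthogonal_transformation_linear)
  have p: "preserves_lborel R" using R by (rule preserves_lborel_orthogonal)
  then have Rm[measurable]: "R \<in> borel_measurable borel" by (simp add: preserves_lborel_def)
  have n: "norm (R x) = norm x" for x using R by (rule orthogonal_transformation_norm)
  show RS: "R \<in> measurable sphere_measure sphere_measure"
    unfolding measurable_cong_sets[OF refl sets_sphere_measure]
    by (rule measurable_restrict_space2)
      (auto simp: space_sphere_measure n intro!: borel_measurable_sphere_measure)
  show "distr sphere_measure sphere_measure R = sphere_measure"
  proof (rule measure_eqI)
    fix A assume "A \<in> sets (distr sphere_measure sphere_measure R)"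
    then have A: "A \<in> sets borel" "A \<subseteq> sphere 0 1" and AS: "A \<in> sets sphere_measure"
      by (auto simp: sets_sphere_measure sets_restrict_space)
    have [measurable]: "A \<in> sets borel" by (rule A)
    let ?B = "{x \<in> cball 0 1 - {0}. x /\<^sub>R norm x \<in> A}"
    have "?B = (cball 0 1 - {0}) \<inter> (\<lambda>x. x /\<^sub>R norm x) -` A" by auto
    also have "\<dots> \<in> sets borel"
    proof (intro sets.Int)
      show "(\<lambda>x. x /\<^sub>R norm x) -` A \<in> sets borel"
        by (rule measurable_sets_borel[OF _ A(1)]) measurable
    qed auto
    finally have B: "?B \<in> sets borel" .
    have RA: "R -` A \<in> sets borel" using measurable_sets[OF Rm A(1)] by simp
    have "emeasure (distr sphere_measure sphere_measure R) A = emeasure sphere_measure (R -` A \<inter> sphere 0 1)"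
      using RS AS by (simp add: emeasure_distr space_sphere_measure)
    also have "R -` A \<inter> sphere 0 1 = R -` A"
      using A(2) n by auto
    also have "emeasure sphere_measure (R -` A)
        = of_nat DIM('a) * emeasure lborel {x \<in> cball 0 1 - {0}. x /\<^sub>R norm x \<in> R -` A}"
      using RA A(2) n by (intro emeasure_sphere_measure) auto
    also have "{x \<in> cball 0 1 - {0}. x /\<^sub>R norm x \<in> R -` A} = R -` ?B"
      using n by (auto simp: linear_scale[OF lin] simp del: norm_eq_zero)
        (metis norm_zero n norm_eq_zero)+
    also have "emeasure lborel (R -` ?B) = emeasure (distr lborel lborel R) ?B"
      using B by (simp add: emeasure_distr)
    also have "\<dots> = emeasure lborel ?B"
      using p by (simp add: preserves_lborel_def)
    also have "of_nat DIM('a) * emeasure lborel ?B = emeasure sphere_measure A"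
      using A by (intro emeasure_sphere_measure[symmetric])
    finally show "emeasure (distr sphere_measure sphere_measure R) A = emeasure sphere_measure A" .
  qed simp
qed

lemma nn_integral_sphere_rotate:
  fixes R :: "'a::euclidean_space \<Rightarrow> 'a" and f :: "'a \<Rightarrow> ennreal"
  assumes R: "orthogonal_transformation R" and f: "f \<in> borel_measurable (completion sphere_measure)"
  shows "(\<integral>\<^sup>+\<omega>. f (R \<omega>) \<partial>sphere_measure) = (\<integral>\<^sup>+\<omega>. f \<omega> \<partial>sphere_measure)"
proof -
  note RS = distr_sphere_measure_orthogonal[OF R]
  obtain g where g: "g \<in> borel_measurable sphere_measure" and ae: "AE x in sphere_measure. f x = g x"
    using completion_ex_borel_measurable[OF f] by auto
  have ae': "AE x in distr sphere_measure sphere_measure R. f x = g x"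
    unfolding RS(2) by (rule ae)
  have "(\<integral>\<^sup>+\<omega>. f (R \<omega>) \<partial>sphere_measure) = (\<integral>\<^sup>+\<omega>. g (R \<omega>) \<partial>sphere_measure)"
    by (intro nn_integral_cong_AE AE_distrD[OF RS(1) ae'])
  also have "\<dots> = (\<integral>\<^sup>+\<omega>. g \<omega> \<partial>distr sphere_measure sphere_measure R)"
    using RS(1) g by (subst nn_integral_distr) auto
  also have "\<dots> = (\<integral>\<^sup>+\<omega>. f \<omega> \<partial>sphere_measure)"
    unfolding RS(2) using ae by (intro nn_integral_cong_AE) auto
  finally show ?thesis .
qed

text \<open>Some orthogonal transformation carries n' to n. This makes the total angular cross
  section independent of the direction of the relative velocity.\<close>

lemma nn_integral_zonal_eq:
  fixes h :: "real \<Rightarrow> real" and n n' :: "real ^ 'n"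
  assumes m: "(\<lambda>\<omega>. h (\<omega> \<bullet> n)) \<in> borel_measurable (completion sphere_measure)"
    and n: "norm n = norm n'"
  shows "(\<integral>\<^sup>+\<omega>. ennreal (h (\<omega> \<bullet> n')) \<partial>sphere_measure) = (\<integral>\<^sup>+\<omega>. ennreal (h (\<omega> \<bullet> n)) \<partial>sphere_measure)"
proof -
  obtain R where R: "orthogonal_transformation R" "R n' = n"
    using orthogonal_transformation_exists[of n' n] n by auto
  have "R \<omega> \<bullet> n = \<omega> \<bullet> n'" for \<omega>
    using R by (auto simp: orthogonal_transformation_def)
  then show ?thesis
    using nn_integral_sphere_rotate[OF R(1), of "\<lambda>\<omega>. ennreal (h (\<omega> \<bullet> n))"] m by simp
qed

section \<open>Global Maxwellians\<close>

text \<open>The exponent of a Maxwellian as a quadratic form in v and y = x - t v, the position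
  traced back to time 0; time enters through y alone.\<close>

definition maxwell_form ::
  "real \<Rightarrow> real \<Rightarrow> real \<Rightarrow> real ^ 'n ^ 'n \<Rightarrow> real ^ 'n \<Rightarrow> real ^ 'n \<Rightarrow> real" where
  "maxwell_form a b c B v y = (c * (norm v)\<^sup>2 + a * (norm y)\<^sup>2 + 2 * b * (y \<bullet> v)) / 2 - v \<bullet> (B *v y)"

lemma inner_skew:
  fixes B :: "real ^ 'n ^ 'n"
  assumes "transpose B = - B"
  shows "x \<bullet> (B *v y) = - ((B *v x) \<bullet> y)"
proof -
  have "x \<bullet> (B *v y) = (x v* B) \<bullet> y" by (rule dot_lmul_matrix[symmetric])
  also have "x v* B = (0 - B) *v x"
    using assms by (simp add: transpose_matrix_vector[symmetric])
  also have "\<dots> = - (B *v x)"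
    unfolding matrix_vector_mult_diff_rdistrib by simp
  finally show ?thesis by simp
qed

text \<open>Completing the square in y: 2 a times the form equals |a y + b v + B v|^2 + v . Q v.
  Thus Q is a times the Schur complement of the y block, and its positivity is the natural
  condition.\<close>

lemma maxwell_form_pos:
  fixes B :: "real ^ 'n ^ 'n"
  assumes "0 < a" and skew: "transpose B = - B"
    and Q: "\<And>y. y \<noteq> 0 \<Longrightarrow> 0 < y \<bullet> (((a * c - b\<^sup>2) *\<^sub>R mat 1 + B ** B) *v y)"
    and "v \<noteq> 0 \<or> y \<noteq> 0"
  shows "0 < maxwell_form a b c B v y"
proof -
  let ?Q = "(a * c - b\<^sup>2) *\<^sub>R mat 1 + B ** B"
  let ?u = "b *\<^sub>R v + B *v v"
  have vBv: "v \<bullet> (B *v v) = 0"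
    using inner_skew[OF skew, of v v] by (simp add: inner_commute)
  have BB: "v \<bullet> (B *v (B *v v)) = - (norm (B *v v))\<^sup>2"
    using inner_skew[OF skew, of v "B *v v"] by (simp add: power2_norm_eq_inner)
  have u: "(norm ?u)\<^sup>2 = b\<^sup>2 * (norm v)\<^sup>2 + (norm (B *v v))\<^sup>2"
    unfolding power2_norm_eq_inner
    by (simp add: inner_add_left inner_add_right vBv inner_commute[of "B *v v" v] power2_eq_square)
  have vQ: "v \<bullet> (?Q *v v) = a * c * (norm v)\<^sup>2 - (norm ?u)\<^sup>2"
    unfolding u
    by (simp add: matrix_vector_mult_add_rdistrib scaleR_matrix_vector_assoc[symmetric] inner_add_right
        matrix_vector_mul_assoc[symmetric] BB power2_norm_eq_inner[symmetric] algebra_simps)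
  have "2 * a * maxwell_form a b c B v y = (norm (a *\<^sub>R y + ?u))\<^sup>2 + v \<bullet> (?Q *v v)"
  proof -
    have "v \<bullet> (B *v y) = - ((B *v v) \<bullet> y)" by (rule inner_skew[OF skew])
    then show ?thesis
      unfolding maxwell_form_def vQ power2_norm_eq_inner
      by (simp add: inner_add_left inner_add_right inner_commute algebra_simps power2_eq_square)
  qed
  also have "\<dots> > 0"
  proof (cases "v = 0")
    case True
    with assms show ?thesis by simp
  next
    case False
    from Q[OF this] show ?thesis by (simp add: add_nonneg_pos)
  qed
  finally show ?thesis using \<open>0 < a\<close> by (simp add: zero_less_mult_iff)
qed

text \<open>\<delta> is the minimum of the form on the unit sphere of phase space, positive by
  compactness; homogeneity of degree two extends the bound to all vectors.\<close>

lemma maxwell_form_coercive: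
  fixes B :: "real ^ 'n ^ 'n"
  assumes pos: "\<And>v y. v \<noteq> 0 \<or> y \<noteq> 0 \<Longrightarrow> 0 < maxwell_form a b c B v y"
  obtains \<delta> where "0 < \<delta>" "\<And>v y. \<delta> * ((norm v)\<^sup>2 + (norm y)\<^sup>2) \<le> maxwell_form a b c B v y"
proof -
  let ?S = "sphere (0 :: (real ^ 'n) \<times> (real ^ 'n)) 1"
  let ?f = "\<lambda>p. maxwell_form a b c B (fst p) (snd p)"
  have ne: "?S \<noteq> {}" by simp
  have "continuous_on ?S ?f"
    unfolding maxwell_form_def by (intro continuous_intros matrix_vector_mult_linear_continuous_on[THEN continuous_on_compose2]) auto
  from continuous_attains_inf[OF compact_sphere ne this]
  obtain p where p: "p \<in> ?S" "\<And>q. q \<in> ?S \<Longrightarrow> ?f p \<le> ?f q" by blast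
  have "p \<noteq> 0" using p(1) by auto
  then have "fst p \<noteq> 0 \<or> snd p \<noteq> 0" by (auto simp: prod_eq_iff)
  then have pp: "0 < ?f p" by (rule pos)
  have scale: "maxwell_form a b c B (r *\<^sub>R v) (r *\<^sub>R y) = r\<^sup>2 * maxwell_form a b c B v y" for r v y
    unfolding maxwell_form_def
    by (simp add: power2_norm_eq_inner matrix_vector_mult_scaleR power2_eq_square algebra_simps)
  have "?f p * ((norm v)\<^sup>2 + (norm y)\<^sup>2) \<le> maxwell_form a b c B v y" for v y
  proof (cases "(v, y) = 0")
    case True
    then show ?thesis by (simp add: zero_prod_def maxwell_form_def)
  next
    case False
    define r where "r = norm (v, y)"
    have r: "0 < r" using False by (simp only: r_def zero_less_norm_iff not_False_eq_True)
    have "norm ((v, y) /\<^sub>R r) = \<bar>inverse r\<bar> * r" by (simp only: norm_scaleR r_def)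
    with r have "(v, y) /\<^sub>R r \<in> ?S" by (simp only: mem_sphere_0) simp
    from p(2)[OF this] have "?f p \<le> maxwell_form a b c B (inverse r *\<^sub>R v) (inverse r *\<^sub>R y)" by simp
    also have "\<dots> = maxwell_form a b c B v y / r\<^sup>2"
      unfolding scale by (simp add: power_inverse divide_inverse mult.commute)
    finally have "?f p * r\<^sup>2 \<le> maxwell_form a b c B v y"
      using r by (simp add: pos_le_divide_eq)
    then show ?thesis by (simp add: r_def norm_prod_def)
  qed
  with pp that show thesis by blast
qed

text \<open>At fixed x and t the exponent is \<alpha> |V|^2 + l . V plus a constant, because
  skewness removes V . B V. It is therefore a combination of the collision invariants energy,
  momentum and mass.\<close>

lemma maxwell_form_collision:
  fixes B :: "real ^ 'n ^ 'n" and V W x :: "real ^ 'n"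
  assumes skew: "transpose B = - B" and \<omega>: "norm \<omega> = 1"
  defines "V' \<equiv> V - ((V - W) \<bullet> \<omega>) *\<^sub>R \<omega>" and "W' \<equiv> W + ((V - W) \<bullet> \<omega>) *\<^sub>R \<omega>"
  shows "maxwell_form a b c B V' (x - t *\<^sub>R V') + maxwell_form a b c B W' (x - t *\<^sub>R W')
       = maxwell_form a b c B V (x - t *\<^sub>R V) + maxwell_form a b c B W (x - t *\<^sub>R W)"
proof -
  define \<alpha> where "\<alpha> = c / 2 + a * t\<^sup>2 / 2 - b * t"
  define l where "l = (b - a * t) *\<^sub>R x - B *v x"
  have q: "maxwell_form a b c B V (x - t *\<^sub>R V) = \<alpha> * (V \<bullet> V) + l \<bullet> V + a / 2 * (x \<bullet> x)" for V
  proof -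
    have VBV: "V \<bullet> (B *v V) = 0"
      using inner_skew[OF skew, of V V] by (simp add: inner_commute)
    have "V \<bullet> (B *v (x - t *\<^sub>R V)) = V \<bullet> (B *v x)"
      by (simp add: matrix_vector_mult_diff_distrib matrix_vector_mult_scaleR inner_diff_right VBV)
    moreover have "(norm (x - t *\<^sub>R V))\<^sup>2 = x \<bullet> x - 2 * t * (x \<bullet> V) + t\<^sup>2 * (V \<bullet> V)"
      unfolding power2_norm_eq_inner
      by (simp add: inner_diff_left inner_diff_right inner_commute[of V x] power2_eq_square algebra_simps)
    moreover have "(x - t *\<^sub>R V) \<bullet> V = x \<bullet> V - t * (V \<bullet> V)"
      by (simp add: inner_diff_left)
    moreover have "l \<bullet> V = (b - a * t) * (x \<bullet> V) - V \<bullet> (B *v x)"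
      by (simp add: l_def inner_diff_left inner_commute[of V "B *v x"])
    ultimately show ?thesis
      by (simp add: maxwell_form_def power2_norm_eq_inner[of V] \<alpha>_def) (simp add: field_simps)
  qed
  have \<omega>1: "\<omega> \<bullet> \<omega> = 1" using \<omega> by (simp add: norm_eq_1)
  have sq: "V' \<bullet> V' + W' \<bullet> W' = V \<bullet> V + W \<bullet> W"
  proof -
    define k where "k = V \<bullet> \<omega> - W \<bullet> \<omega>"
    have e: "V' = V - k *\<^sub>R \<omega>" "W' = W + k *\<^sub>R \<omega>"
      unfolding V'_def W'_def k_def by (simp_all add: inner_diff_left)
    have "V' \<bullet> V' = V \<bullet> V - 2 * k * (V \<bullet> \<omega>) + k * k" "W' \<bullet> W' = W \<bullet> W + 2 * k * (W \<bullet> \<omega>) + k * k"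
      unfolding e using \<omega>1 by (simp_all add: inner_add_left inner_add_right inner_diff_left inner_diff_right
          inner_commute[of \<omega> V] inner_commute[of \<omega> W] algebra_simps)
    then show ?thesis by (simp add: k_def algebra_simps)
  qed
  have ln: "l \<bullet> V' + l \<bullet> W' = l \<bullet> V + l \<bullet> W"
    unfolding V'_def W'_def by (simp add: inner_add_right inner_diff_right)
  have "\<alpha> * (V' \<bullet> V') + \<alpha> * (W' \<bullet> W') = \<alpha> * (V \<bullet> V) + \<alpha> * (W \<bullet> W)"
    using sq by (simp add: distrib_left[symmetric])
  with ln show ?thesis unfolding q by linarith
qed

text \<open>What the integral and limit estimates retain of a Maxwellian. The sign of
  \<open>A\<close> is that of a determinant and is left open: absolute values replace it in the
  integral bounds, and where it matters it is deduced from |F| \<le> M.\<close>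

definition streaming_gaussian ::
  "((real ^ 'n) \<times> (real ^ 'n) \<times> real \<Rightarrow> real) \<Rightarrow> real \<Rightarrow> (real ^ 'n \<Rightarrow> real ^ 'n \<Rightarrow> real) \<Rightarrow>
   real ^ 'n \<Rightarrow> real ^ 'n \<Rightarrow> real \<Rightarrow> bool" where
  "streaming_gaussian M A q v0 x0 \<delta> \<longleftrightarrow>
     M = (\<lambda>(v, x, t). A * exp (- q (v - v0) (x - x0 - t *\<^sub>R (v - v0)))) \<and>
     continuous_on UNIV (\<lambda>p. q (fst p) (snd p)) \<and>
     0 < \<delta> \<and> (\<forall>v y. \<delta> * ((norm v)\<^sup>2 + (norm y)\<^sup>2) \<le> q v y)"

lemma
  fixes M :: "(real ^ 'n) \<times> (real ^ 'n) \<times> real \<Rightarrow> real"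
  assumes "global_maxwellian M"
  shows global_maxwellian_gaussian: "\<exists>A q v0 x0 \<delta>. streaming_gaussian M A q v0 x0 \<delta>"
    and global_maxwellian_collision: "\<And>v w x t \<omega>. norm \<omega> = 1 \<Longrightarrow>
      M (post1 v w \<omega>, x, t) * M (post2 v w \<omega>, x, t) = M (v, x, t) * M (w, x, t)"
proof -
  from assms obtain m a c b :: real and x0 v0 :: "real ^ 'n" and B :: "real ^ 'n ^ 'n" where
    a: "0 < a" and skew: "transpose B = - B"
    and Q: "\<And>y. y \<noteq> 0 \<Longrightarrow> 0 < y \<bullet> (((a * c - b\<^sup>2) *\<^sub>R mat 1 + B ** B) *v y)"
    and M: "M = (\<lambda>(v, x, t). m / (2 * pi) ^ CARD('n) * sqrt (det ((a * c - b\<^sup>2) *\<^sub>R mat 1 + B ** B)) *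
      exp (- maxwell_form a b c B (v - v0) (x - x0 - t *\<^sub>R (v - v0))))"
    unfolding global_maxwellian_def Let_def maxwell_form_def by blast
  let ?A = "m / (2 * pi) ^ CARD('n) * sqrt (det ((a * c - b\<^sup>2) *\<^sub>R mat 1 + B ** B))"
  note pos = maxwell_form_pos[OF a skew Q]
  obtain \<delta> where \<delta>: "0 < \<delta>" "\<And>v y. \<delta> * ((norm v)\<^sup>2 + (norm y)\<^sup>2) \<le> maxwell_form a b c B v y"
    using maxwell_form_coercive[OF pos] by metis
  have cont: "continuous_on UNIV (\<lambda>p. maxwell_form a b c B (fst p) (snd p))"
    unfolding maxwell_form_def
    by (intro continuous_intros matrix_vector_mult_linear_continuous_on[THEN continuous_on_compose2]) auto
  show "M (post1 v w \<omega>, x, t) * M (post2 v w \<omega>, x, t) = M (v, x, t) * M (w, x, t)"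
    if \<omega>: "norm \<omega> = 1" for v w x t \<omega>
  proof -
    \<comment> \<open>The collision map commutes with translating both velocities by
      \<open>v0\<close>, so the identity for the centred form applies.\<close>
    have p: "post1 v w \<omega> - v0 = (v - v0) - (((v - v0) - (w - v0)) \<bullet> \<omega>) *\<^sub>R \<omega>"
      "post2 v w \<omega> - v0 = (w - v0) + (((v - v0) - (w - v0)) \<bullet> \<omega>) *\<^sub>R \<omega>"
      by (simp_all add: post1_def post2_def)
    have e: "exp (- maxwell_form a b c B (post1 v w \<omega> - v0) (x - x0 - t *\<^sub>R (post1 v w \<omega> - v0)))
       * exp (- maxwell_form a b c B (post2 v w \<omega> - v0) (x - x0 - t *\<^sub>R (post2 v w \<omega> - v0)))
      = exp (- maxwell_form a b c B (v - v0) (x - x0 - t *\<^sub>R (v - v0)))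
       * exp (- maxwell_form a b c B (w - v0) (x - x0 - t *\<^sub>R (w - v0)))"
      unfolding exp_add[symmetric] p
      using maxwell_form_collision[OF skew \<omega>, of a b c "v - v0" "w - v0" "x - x0" t] by simp
    have "(?A * e1) * (?A * e2) = ?A * ?A * (e1 * e2)" for e1 e2 by simp
    then show ?thesis unfolding M using e by (simp only: prod.case)
  qed
  have "streaming_gaussian M ?A (maxwell_form a b c B) v0 x0 \<delta>"
    unfolding streaming_gaussian_def using M cont \<delta> by blast
  then show "\<exists>A q v0 x0 \<delta>. streaming_gaussian M A q v0 x0 \<delta>" by blast
qed

section \<open>Pointwise bound on the collision integral\<close>

text \<open>\<open>C\<close> is the angular integral of h against one fixed direction
  \<open>n0\<close>; rotation invariance makes it serve every z. At z = 0 the kernel has no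
  prescribed value, so that z is excluded throughout.\<close>

lemma separated_kernel_bound:
  fixes k :: "real ^ 'n \<Rightarrow> real ^ 'n \<Rightarrow> real"
  assumes "separated_kernel \<beta> k"
  obtains C :: ennreal where "C < \<infinity>"
    and "\<And>z. z \<noteq> 0 \<Longrightarrow> k z \<in> borel_measurable (completion sphere_measure)"
    and "\<And>z \<omega>. z \<noteq> 0 \<Longrightarrow> norm \<omega> = 1 \<Longrightarrow> 0 \<le> k z \<omega>"
    and "\<And>z. z \<noteq> 0 \<Longrightarrow> (\<integral>\<^sup>+\<omega>. ennreal (k z \<omega>) \<partial>sphere_measure) = C * ennreal (norm z powr \<beta>)"
proof -
  from assms obtain h :: "real \<Rightarrow> real" where
    h0: "\<And>s. s \<in> {-1..1} \<Longrightarrow> 0 \<le> h s"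
    and hi: "\<And>n :: real ^ 'n. norm n = 1 \<Longrightarrow> integrable (completion sphere_measure) (\<lambda>\<omega>. h (\<omega> \<bullet> n))"
    and k: "\<And>z \<omega>. z \<noteq> 0 \<Longrightarrow> norm \<omega> = 1 \<Longrightarrow> k z \<omega> = norm z powr \<beta> * h (\<omega> \<bullet> (z /\<^sub>R norm z))"
    unfolding separated_kernel_def by blast
  obtain n0 :: "real ^ 'n" where n0: "norm n0 = 1" using norm_axis_1 by blast
  let ?C = "\<integral>\<^sup>+\<omega>. ennreal (h (\<omega> \<bullet> n0)) \<partial>sphere_measure"
  have h_nn: "0 \<le> h (\<omega> \<bullet> n)" if "norm \<omega> = 1" "norm n = 1" for \<omega> n :: "real ^ 'n"
    using Cauchy_Schwarz_ineq2[of \<omega> n] that by (intro h0) auto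
  have unit: "norm (z /\<^sub>R norm z) = 1" if "z \<noteq> 0" for z :: "real ^ 'n"
    using that by simp
  have sp: "norm \<omega> = 1" if "\<omega> \<in> space (sphere_measure :: (real ^ 'n) measure)" for \<omega>
    using that by (simp add: space_sphere_measure)
  show thesis
  proof (rule that)
    have "?C = (\<integral>\<^sup>+\<omega>. ennreal (norm (h (\<omega> \<bullet> n0))) \<partial>completion sphere_measure)"
      unfolding nn_integral_completion using h_nn n0 sp by (intro nn_integral_cong) simp
    also have "\<dots> < \<infinity>" using hi[OF n0] by (simp add: integrable_iff_bounded)
    finally show "?C < \<infinity>" .
    fix z :: "real ^ 'n" assume z: "z \<noteq> 0"
    let ?n = "z /\<^sub>R norm z"
    have hm: "(\<lambda>\<omega>. h (\<omega> \<bullet> ?n)) \<in> borel_measurable (completion sphere_measure)"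
      using hi[OF unit[OF z]] by (rule borel_measurable_integrable)
    have "(\<lambda>\<omega>. norm z powr \<beta> * h (\<omega> \<bullet> ?n)) \<in> borel_measurable (completion sphere_measure)"
      using hm by measurable
    then show "k z \<in> borel_measurable (completion sphere_measure)"
      by (rule measurable_cong[THEN iffD1, rotated]) (simp add: k[OF z] sp)
    have "(\<integral>\<^sup>+\<omega>. ennreal (k z \<omega>) \<partial>sphere_measure)
        = (\<integral>\<^sup>+\<omega>. ennreal (norm z powr \<beta>) * ennreal (h (\<omega> \<bullet> ?n)) \<partial>completion sphere_measure)"
      unfolding nn_integral_completion
    proof (rule nn_integral_cong)
      fix \<omega> :: "real ^ 'n" assume "\<omega> \<in> space sphere_measure"
      then have "norm \<omega> = 1" by (rule sp)
      then show "ennreal (k z \<omega>) = ennreal (norm z powr \<beta>) * ennreal (h (\<omega> \<bullet> ?n))"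
        using h_nn[OF _ unit[OF z]] by (simp only: k[OF z] ennreal_mult powr_ge_zero)
    qed
    also have "\<dots> = ennreal (norm z powr \<beta>) * (\<integral>\<^sup>+\<omega>. ennreal (h (\<omega> \<bullet> ?n)) \<partial>completion sphere_measure)"
      using hm by (intro nn_integral_cmult) measurable
    also have "(\<integral>\<^sup>+\<omega>. ennreal (h (\<omega> \<bullet> ?n)) \<partial>completion sphere_measure) = ?C"
      unfolding nn_integral_completion using hi[OF n0] unit[OF z] n0
      by (intro nn_integral_zonal_eq) auto
    finally show "(\<integral>\<^sup>+\<omega>. ennreal (k z \<omega>) \<partial>sphere_measure) = ?C * ennreal (norm z powr \<beta>)"
      by (simp add: mult.commute)
  next
    fix z \<omega> :: "real ^ 'n" assume z: "z \<noteq> 0" "norm \<omega> = 1"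
    show "0 \<le> k z \<omega>"
      unfolding k[OF z] using h_nn[OF z(2) unit[OF z(1)]] by (intro mult_nonneg_nonneg) auto
  qed
qed

text \<open>Tonelli for a function that is measurable only for the completed product. It agrees with
  a product measurable one off a null set, almost every slice of which is null; the slices wanted
  here are those at fixed w.\<close>

lemma nn_integral_completion_pair_le:
  fixes f :: "'a \<times> 'b \<Rightarrow> ennreal"
  assumes S: "sigma_finite_measure S" and L: "sigma_finite_measure L"
    and f: "f \<in> borel_measurable (completion (S \<Otimes>\<^sub>M L))"
    and le: "AE w in L. (\<integral>\<^sup>+\<omega>. f (\<omega>, w) \<partial>S) \<le> g w"
  shows "(\<integral>\<^sup>+p. f p \<partial>completion (S \<Otimes>\<^sub>M L)) \<le> (\<integral>\<^sup>+w. g w \<partial>L)"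
proof -
  interpret pair_sigma_finite S L using S L by (simp add: pair_sigma_finite_def)
  obtain f' where f': "f' \<in> borel_measurable (S \<Otimes>\<^sub>M L)" and "AE p in S \<Otimes>\<^sub>M L. f p = f' p"
    using completion_ex_borel_measurable[OF f] by auto
  then obtain N where N: "N \<in> null_sets (S \<Otimes>\<^sub>M L)" "{p \<in> space (S \<Otimes>\<^sub>M L). f p \<noteq> f' p} \<subseteq> N"
    by (auto elim!: AE_E)
  have [measurable]: "N \<in> sets (S \<Otimes>\<^sub>M L)" using N(1) by auto
  have "AE p in S \<Otimes>\<^sub>M L. p \<notin> N" using N(1) by (rule AE_not_in)
  from AE_pair[OF this] have "AE \<omega> in S. AE w in L. (\<omega>, w) \<notin> N" .
  then have ae: "AE w in L. AE \<omega> in S. (\<omega>, w) \<notin> N"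
    by (subst (asm) AE_commute) (simp, measurable)
  have "(\<integral>\<^sup>+p. f p \<partial>completion (S \<Otimes>\<^sub>M L)) = (\<integral>\<^sup>+p. f' p \<partial>(S \<Otimes>\<^sub>M L))"
    unfolding nn_integral_completion by (rule nn_integral_cong_AE) fact
  also have "\<dots> = (\<integral>\<^sup>+w. (\<integral>\<^sup>+\<omega>. f' (\<omega>, w) \<partial>S) \<partial>L)"
    using f' by (rule nn_integral_snd[symmetric])
  also have "\<dots> \<le> (\<integral>\<^sup>+w. g w \<partial>L)"
  proof (rule nn_integral_mono_AE)
    show "AE w in L. (\<integral>\<^sup>+\<omega>. f' (\<omega>, w) \<partial>S) \<le> g w"
      using ae le AE_space
    proof eventually_elim
      case (elim w)
      have "(\<integral>\<^sup>+\<omega>. f' (\<omega>, w) \<partial>S) = (\<integral>\<^sup>+\<omega>. f (\<omega>, w) \<partial>S)"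
      proof (rule nn_integral_cong_AE)
        show "AE \<omega> in S. f' (\<omega>, w) = f (\<omega>, w)"
          using elim(1) AE_space
        proof eventually_elim
          case (elim \<omega>)
          then show ?case using N(2) \<open>w \<in> space L\<close> by (force simp: space_pair_measure)
        qed
      qed
      with elim(2) show ?case by simp
    qed
  qed
  finally show ?thesis .
qed

text \<open>For fixed relative velocity \<open>z = v - w\<close> and fixed \<open>\<omega>\<close>, each of the maps \<open>v \<mapsto> v'\<close>, \<open>v \<mapsto> v\<^sub>*'\<close>
  and \<open>v \<mapsto> v\<^sub>*\<close> is a translation, hence preserves null sets.\<close>

lemma AE_velocity_translate:
  fixes c :: "'a::euclidean_space \<times> 'a \<Rightarrow> 'a" and P :: "'a \<times> 'a \<times> real \<Rightarrow> bool"
  assumes P: "AE p in lborel. P p" and c: "c \<in> borel_measurable borel"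
  shows "AE p in lborel. AE w in lborel. AE \<omega> in sphere_measure.
    P (fst p + c (fst p - w, \<omega>), snd p)"
proof -
  interpret S: finite_measure "sphere_measure :: 'a measure" by (rule finite_sphere_measure)
  interpret A: pair_sigma_finite "lborel :: 'a measure" "sphere_measure :: 'a measure" ..
  interpret LS: sigma_finite_measure "lborel \<Otimes>\<^sub>M (sphere_measure :: 'a measure)"
    by (rule sigma_finite_pair_measure) unfold_locales
  interpret B: pair_sigma_finite "lborel :: ('a \<times> 'a \<times> real) measure" "lborel \<Otimes>\<^sub>M (sphere_measure :: 'a measure)" ..
  obtain N where N: "N \<in> null_sets lborel" "{p. \<not> P p} \<subseteq> N"
    using P unfolding eventually_ae_filter by auto
  then have N_sets: "N \<in> sets borel" by auto
  have AEN: "AE p in lborel. p \<notin> N" using N(1) by (rule AE_not_in)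
  let ?T = "\<lambda>p y. (fst p + c y, snd p) :: 'a \<times> 'a \<times> real"
  have id: "(\<lambda>\<omega>. \<omega>) \<in> measurable (sphere_measure :: 'a measure) borel"
    by (intro borel_measurable_sphere_measure) simp
  have "(\<lambda>y. y) \<in> measurable (lborel \<Otimes>\<^sub>M sphere_measure) (borel \<Otimes>\<^sub>M (borel :: 'a measure))"
    using measurable_compose[OF measurable_snd id] by (intro measurable_pair) (simp_all add: comp_def)
  then have c': "c \<in> borel_measurable (lborel \<Otimes>\<^sub>M sphere_measure)"
    by (rule measurable_compose) (use c in \<open>simp add: borel_prod\<close>)
  have T: "(\<lambda>q. ?T (fst q) (snd q)) \<in> measurable (lborel \<Otimes>\<^sub>M (lborel \<Otimes>\<^sub>M sphere_measure)) borel"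
  proof -
    have f: "fst \<in> measurable (lborel :: ('a \<times> 'a \<times> real) measure) borel"
      and g: "snd \<in> measurable (lborel :: ('a \<times> 'a \<times> real) measure) borel"
      by (auto intro!: borel_measurable_continuous_onI continuous_intros)
    have "(\<lambda>q. fst (fst q) + c (snd q)) \<in> measurable ((lborel :: ('a \<times> 'a \<times> real) measure) \<Otimes>\<^sub>M (lborel \<Otimes>\<^sub>M sphere_measure)) borel"
      by (intro borel_measurable_add measurable_compose[OF measurable_fst f] measurable_compose[OF measurable_snd c'])
    from measurable_Pair[OF this measurable_compose[OF measurable_fst g]] show ?thesis by (simp add: borel_prod)
  qed
  \<comment> \<open>Quantifiers are exchanged so that the pair y of relative velocity and angle
    comes first. For fixed y the map is the translation of space-time by
    \<open>(c y, 0)\<close>.\<close>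
  have "AE p in lborel. AE y in lborel \<Otimes>\<^sub>M sphere_measure. ?T p y \<notin> N"
  proof (subst B.AE_commute)
    have "{q \<in> space (lborel \<Otimes>\<^sub>M (lborel \<Otimes>\<^sub>M sphere_measure)). ?T (fst q) (snd q) \<in> - N}
        \<in> sets (lborel \<Otimes>\<^sub>M (lborel \<Otimes>\<^sub>M sphere_measure))"
      using measurable_sets[OF T, of "- N"] N_sets by (simp add: vimage_def Int_def conj_commute)
    then show "{q \<in> space (lborel \<Otimes>\<^sub>M (lborel \<Otimes>\<^sub>M sphere_measure)). ?T (fst q) (snd q) \<notin> N}
        \<in> sets (lborel \<Otimes>\<^sub>M (lborel \<Otimes>\<^sub>M sphere_measure))" by simp
    have "AE p in lborel. ?T p y \<notin> N" for y
    proof -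
      have "preserves_lborel (\<lambda>p. (c y, 0) + p :: 'a \<times> 'a \<times> real)"
        by (intro preserves_lborelI nn_integral_lborel_translate) auto
      from preserves_lborel_AE[OF this AEN] show ?thesis
        by (simp add: plus_prod_def add.commute)
    qed
    then show "AE y in lborel \<Otimes>\<^sub>M sphere_measure. AE p in lborel. ?T p y \<notin> N" by simp
  qed
  then show ?thesis
  proof eventually_elim
    case (elim p)
    from A.AE_pair[OF elim] have "AE z in lborel. AE \<omega> in sphere_measure. ?T p (z, \<omega>) \<notin> N" .
    \<comment> \<open>Returns from the relative velocity z to w = v - z, a reflection composed with
      a translation.\<close>
    moreover have "preserves_lborel (\<lambda>w. fst p - w)"
      by (intro preserves_lborelI nn_integral_lborel_reflect) auto
    ultimately have "AE w in lborel. AE \<omega> in sphere_measure. ?T p (fst p - w, \<omega>) \<notin> N"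
      by (rule preserves_lborel_AE[rotated])
    then show ?case using N(2) by (auto elim!: eventually_mono)
  qed
qed

text \<open>The factor 2 counts the gain and the loss term: each is at most M(v) M(w) times the
  kernel, the gain term because \<open>M\<close> is invariant under collisions. The angular integral
  then yields \<open>C\<close> and the power of |v - w|.\<close>

lemma collision_bound:
  fixes k :: "real ^ 'n \<Rightarrow> real ^ 'n \<Rightarrow> real" and F M :: "(real ^ 'n) \<times> (real ^ 'n) \<times> real \<Rightarrow> real"
  assumes C: "\<And>z. z \<noteq> 0 \<Longrightarrow> k z \<in> borel_measurable (completion sphere_measure)"
    "\<And>z \<omega>. z \<noteq> 0 \<Longrightarrow> norm \<omega> = 1 \<Longrightarrow> 0 \<le> k z \<omega>"
    "\<And>z. z \<noteq> 0 \<Longrightarrow> (\<integral>\<^sup>+\<omega>. ennreal (k z \<omega>) \<partial>sphere_measure) = C * ennreal (norm z powr \<beta>)"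
    and M: "\<And>v w x t \<omega>. norm \<omega> = 1 \<Longrightarrow>
      M (post1 v w \<omega>, x, t) * M (post2 v w \<omega>, x, t) = M (v, x, t) * M (w, x, t)"
    and FM: "AE (v, x, t) in lborel. t \<in> I \<longrightarrow> \<bar>F (v, x, t)\<bar> \<le> M (v, x, t)"
  shows "AE (v, x, t) in lborel. t \<in> I \<longrightarrow> ennreal \<bar>collision k F (v, x, t)\<bar>
    \<le> (\<integral>\<^sup>+w. 2 * C * ennreal (M (v, x, t) * M (w, x, t) * norm (v - w) powr \<beta>) \<partial>lborel)"
proof -
  let ?P = "\<lambda>p. snd (snd p) \<in> I \<longrightarrow> \<bar>F p\<bar> \<le> M p"
  have P: "AE p in lborel. ?P p" using FM by (simp add: case_prod_beta')
  \<comment> \<open>Three instances of the translation lemma: v', v_*' and w, each written as v plus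
    a function of the relative velocity and \<omega>.\<close>
  have "AE p in lborel. AE w in lborel. AE \<omega> in sphere_measure. ?P (fst p + - (((fst p - w) \<bullet> \<omega>) *\<^sub>R \<omega>), snd p)"
    using AE_velocity_translate[OF P, of "\<lambda>y. - ((fst y \<bullet> snd y) *\<^sub>R snd y)"]
    by (simp add: borel_measurable_continuous_onI continuous_intros)
  moreover have "AE p in lborel. AE w in lborel. AE \<omega> in sphere_measure.
      ?P (fst p + (- (fst p - w) + ((fst p - w) \<bullet> \<omega>) *\<^sub>R \<omega>), snd p)"
    using AE_velocity_translate[OF P, of "\<lambda>y. - fst y + (fst y \<bullet> snd y) *\<^sub>R snd y"]
    by (simp add: borel_measurable_continuous_onI continuous_intros)
  moreover have "AE p in lborel. AE w in lborel. AE \<omega> in (sphere_measure :: (real ^ 'n) measure).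
      ?P (fst p + - (fst p - w), snd p)"
    using AE_velocity_translate[OF P, of "\<lambda>y. - fst y"]
    by (simp add: borel_measurable_continuous_onI continuous_intros)
  moreover note P
  ultimately have "AE p in lborel. case p of (v, x, t) \<Rightarrow> t \<in> I \<longrightarrow> ennreal \<bar>collision k F (v, x, t)\<bar>
    \<le> (\<integral>\<^sup>+w. 2 * C * ennreal (M (v, x, t) * M (w, x, t) * norm (v - w) powr \<beta>) \<partial>lborel)"
  proof eventually_elim
    case (elim p)
    obtain v x t where p: "p = (v, x, t)" by (metis prod.exhaust)
    let ?R = "\<integral>\<^sup>+w. 2 * C * ennreal (M (v, x, t) * M (w, x, t) * norm (v - w) powr \<beta>) \<partial>lborel"
    let ?f = "collision_integrand k F (v, x, t)"
    have "ennreal \<bar>collision k F (v, x, t)\<bar> \<le> ?R" if t: "t \<in> I"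
    proof (cases "integrable collision_measure ?f")
      \<comment> \<open>The Bochner integral then defaults to \<open>0\<close>, and the bound is
        trivial.\<close>
      case False
      then show ?thesis by (simp add: collision_def not_integrable_integral_eq)
    next
      case True
      have e: "v + - (((v - w) \<bullet> \<omega>) *\<^sub>R \<omega>) = post1 v w \<omega>"
        "v + (- (v - w) + ((v - w) \<bullet> \<omega>) *\<^sub>R \<omega>) = post2 v w \<omega>" "v + - (v - w) = w" for w \<omega>
        by (simp_all add: post1_def post2_def)
      have "ennreal \<bar>collision k F (v, x, t)\<bar> \<le> (\<integral>\<^sup>+y. ennreal \<bar>?f y\<bar> \<partial>collision_measure)"
        unfolding collision_def using integral_norm_bound_ennreal[OF True] by simp
      also have "\<dots> \<le> ?R"
      proof (rule nn_integral_completion_pair_le)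
        show "sigma_finite_measure (sphere_measure :: (real ^ 'n) measure)"
          using finite_sphere_measure by (rule finite_measure.axioms(1))
        show "sigma_finite_measure (lborel :: (real ^ 'n) measure)" ..
        show "(\<lambda>y. ennreal \<bar>?f y\<bar>) \<in> borel_measurable collision_measure"
          using borel_measurable_integrable[OF True] by measurable
        show "AE w in lborel. (\<integral>\<^sup>+\<omega>. ennreal \<bar>?f (\<omega>, w)\<bar> \<partial>sphere_measure)
            \<le> 2 * C * ennreal (M (v, x, t) * M (w, x, t) * norm (v - w) powr \<beta>)"
          using elim(1-3)[unfolded p fst_conv snd_conv e] AE_lborel_singleton[of v]
        proof eventually_elim
          case (elim w)
          have z: "v - w \<noteq> 0" using elim(4) by simp
          let ?m = "2 * (M (v, x, t) * M (w, x, t))"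
          have FMv: "\<bar>F (v, x, t)\<bar> \<le> M (v, x, t)" using \<open>?P p\<close> t by (simp add: p)
          have le: "AE \<omega> in sphere_measure. ennreal \<bar>?f (\<omega>, w)\<bar> \<le> ennreal ?m * ennreal (k (v - w) \<omega>)"
            using elim(1-3) AE_space
          proof eventually_elim
            case (elim \<omega>)
            have \<omega>: "norm \<omega> = 1" using elim(4) by (simp add: space_sphere_measure)
            have kk: "0 \<le> k (v - w) \<omega>" using C(2)[OF z \<omega>] .
            have b: "\<bar>F (post1 v w \<omega>, x, t)\<bar> \<le> M (post1 v w \<omega>, x, t)"
              "\<bar>F (post2 v w \<omega>, x, t)\<bar> \<le> M (post2 v w \<omega>, x, t)" "\<bar>F (w, x, t)\<bar> \<le> M (w, x, t)"
              using elim t by auto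
            have 1: "\<bar>F (post1 v w \<omega>, x, t) * F (post2 v w \<omega>, x, t)\<bar> \<le> M (v, x, t) * M (w, x, t)"
              unfolding M[OF \<omega>, of v w x t, symmetric] abs_mult using b by (intro mult_mono) auto
            have 2: "\<bar>F (v, x, t) * F (w, x, t)\<bar> \<le> M (v, x, t) * M (w, x, t)"
              unfolding abs_mult using b FMv by (intro mult_mono) auto
            have "\<bar>F (post1 v w \<omega>, x, t) * F (post2 v w \<omega>, x, t) - F (v, x, t) * F (w, x, t)\<bar> \<le> ?m"
              using 1 2 by linarith
            then have "\<bar>?f (\<omega>, w)\<bar> \<le> ?m * k (v - w) \<omega>"
              unfolding collision_integrand_def using kk by (simp add: abs_mult mult_right_mono)
            moreover have "0 \<le> ?m" using 2 by linarith
            ultimately show ?case using kk by (simp add: ennreal_mult[symmetric] ennreal_leI)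
          qed
          have "(\<integral>\<^sup>+\<omega>. ennreal \<bar>?f (\<omega>, w)\<bar> \<partial>sphere_measure)
              \<le> (\<integral>\<^sup>+\<omega>. ennreal ?m * ennreal (k (v - w) \<omega>) \<partial>completion sphere_measure)"
            unfolding nn_integral_completion using le by (rule nn_integral_mono_AE)
          also have "\<dots> = ennreal ?m * (C * ennreal (norm (v - w) powr \<beta>))"
            unfolding C(3)[OF z, symmetric] nn_integral_completion[symmetric, where M=sphere_measure]
            using C(1)[OF z] by (intro nn_integral_cmult) measurable
          also have "\<dots> = 2 * C * ennreal (M (v, x, t) * M (w, x, t) * norm (v - w) powr \<beta>)"
          proof -
            have "ennreal ?m = 2 * ennreal (M (v, x, t) * M (w, x, t))"
              by (subst ennreal_mult') simp_all
            moreover have "ennreal (M (v, x, t) * M (w, x, t) * norm (v - w) powr \<beta>)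
                = ennreal (M (v, x, t) * M (w, x, t)) * ennreal (norm (v - w) powr \<beta>)"
              by (rule ennreal_mult'') simp
            ultimately show ?thesis by (simp only: mult_ac)
          qed
          finally show ?case .
        qed
      qed
      finally show ?thesis .
    qed
    then show ?case by (simp add: p)
  qed
  then show ?thesis .
qed

section \<open>Limits in \<open>L\<^sup>1\<close>\<close>

lemma borel_measurable_lebesgue_AE:
  fixes f g :: "'a::euclidean_space \<Rightarrow> 'b::topological_space"
  assumes g: "g \<in> borel_measurable lebesgue" and ae: "AE x in lborel. f x = g x"
  shows "f \<in> borel_measurable lebesgue"
proof (rule measurableI)
  fix A :: "'b set" assume A: "A \<in> sets borel"
  show "f -` A \<inter> space lebesgue \<in> sets lebesgue"
  proof (rule completion.in_sets_AE)
    show "AE x in lebesgue. x \<in> g -` A \<inter> space lebesgue \<longleftrightarrow> x \<in> f -` A \<inter> space lebesgue"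
      using AE_completion[OF ae] by (auto elim!: eventually_mono)
    show "g -` A \<inter> space lebesgue \<in> sets lebesgue" using g A by (rule measurable_sets)
  qed simp
qed simp

text \<open>Truncations to a compact exhaustion of S are integrable, hence measurable, and at each
  point they are eventually equal to the function restricted to S.\<close>

lemma L1_loc_measurable:
  fixes f :: "'a::euclidean_space \<Rightarrow> real"
  assumes "open S" "L1_loc S f"
  shows "(\<lambda>x. indicator S x * f x) \<in> borel_measurable lebesgue"
proof -
  obtain C where C: "\<And>n. compact (C n)" "\<And>n. C n \<subseteq> S" "\<And>n. C n \<subseteq> interior (C (Suc n))" "\<Union>(range C) = S"
    using open_Union_compact_subsets[OF assms(1)] by metis
  have mono: "C m \<subseteq> C n" if "m \<le> n" for m n
    using that by (rule lift_Suc_mono_le[rotated]) (use C(3) interior_subset in blast)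
  show ?thesis
  proof (rule borel_measurable_LIMSEQ_real)
    fix n
    have "f absolutely_integrable_on C n"
      using assms(2) C by (auto simp: L1_loc_def)
    then show "(\<lambda>x. indicator (C n) x * f x) \<in> borel_measurable lebesgue"
      unfolding set_integrable_def by (auto dest: borel_measurable_integrable)
  next
    fix x
    have "\<forall>\<^sub>F n in sequentially. indicator (C n) x * f x = indicator S x * f x"
    proof (cases "x \<in> S")
      case True
      then obtain N where "x \<in> C N" using C(4) by auto
      then have "x \<in> C n" if "n \<ge> N" for n using mono[OF that] by auto
      with True show ?thesis unfolding eventually_sequentially by (intro exI[of _ N]) auto
    next
      case False
      then have "x \<notin> C n" for n using C(2) by auto
      with False show ?thesis by simp
    qed
    then show "(\<lambda>n. indicator (C n) x * f x) \<longlonglongrightarrow> indicator S x * f x"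
      by (rule tendsto_eventually)
  qed
qed

section \<open>Slices of null sets and cumulative time integrals\<close>

lemma AE_lborel_pair:
  assumes "AE q in (lborel :: ('a::euclidean_space \<times> 'b::euclidean_space) measure). P q"
  shows "AE x in lborel. AE y in lborel. P (x, y)"
  using assms unfolding lborel_prod[symmetric] by (rule lborel_pair.AE_pair)

lemma AE_lborel_pair_swap:
  assumes "AE q in (lborel :: ('a::euclidean_space \<times> 'b::euclidean_space) measure). P q"
  shows "AE y in lborel. AE x in lborel. P (x, y)"
proof -
  have "preserves_lborel (\<lambda>(y, x). (x, y) :: 'a \<times> 'b)"
  proof (rule preserves_lborelI)
    show "(\<lambda>(y, x). (x, y) :: 'a \<times> 'b) \<in> borel_measurable borel"
      unfolding case_prod_beta' by (intro borel_measurable_continuous_onI continuous_intros)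
    fix f :: "'a \<times> 'b \<Rightarrow> ennreal" assume f: "f \<in> borel_measurable borel"
    have m: "(\<lambda>p. f (snd p, fst p)) \<in> borel_measurable borel"
      by (intro borel_measurable_comp_continuous[OF f] continuous_intros)
    then have "(\<integral>\<^sup>+p. f (snd p, fst p) \<partial>lborel) = (\<integral>\<^sup>+y. (\<integral>\<^sup>+x. f (x, y) \<partial>lborel) \<partial>lborel)"
      by (subst nn_integral_lborel_pair) simp_all
    also have "\<dots> = (\<integral>\<^sup>+x. (\<integral>\<^sup>+y. f (x, y) \<partial>lborel) \<partial>lborel)"
      by (rule nn_integral_lborel_swap) (use m in \<open>simp add: case_prod_beta'\<close>)
    also have "\<dots> = (\<integral>\<^sup>+p. f p \<partial>lborel)"
      using f by (rule nn_integral_lborel_pair[symmetric])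
    finally show "(\<integral>\<^sup>+p. f (case p of (y, x) \<Rightarrow> (x, y)) \<partial>lborel) = (\<integral>\<^sup>+p. f p \<partial>lborel)"
      by (simp add: case_prod_beta')
  qed
  from AE_lborel_pair[OF preserves_lborel_AE[OF this assms]] show ?thesis by simp
qed

lemma AE_lborel_exists:
  fixes a b :: real
  assumes "AE t in lborel. P t" "a < b"
  shows "\<exists>t. a < t \<and> t < b \<and> P t"
proof (rule ccontr)
  assume "\<not> ?thesis"
  with assms(1) have "AE t in lborel. t \<notin> {a<..<b}" by (auto elim!: eventually_mono)
  then have "emeasure lborel {a<..<b} = 0"
    by (subst (asm) AE_iff_measurable[of "{a<..<b}"]) auto
  with assms(2) show False by simp
qed

lemma borel_measurable_cumulative:
  fixes f :: "'a::euclidean_space \<times> real \<Rightarrow> real"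
  assumes "f \<in> borel_measurable borel" "J \<in> sets borel"
  shows "(\<lambda>p. LINT s|lborel. indicator J s * f (p, s)) \<in> borel_measurable borel"
proof -
  have s: "sets (borel \<Otimes>\<^sub>M (lborel :: real measure)) = sets (borel :: ('a \<times> real) measure)"
    unfolding borel_prod[symmetric] by (rule sets_pair_measure_cong) simp_all
  have "(\<lambda>q. indicator J (snd q) :: real) \<in> borel_measurable (borel :: ('a \<times> real) measure)"
    using borel_measurable_comp_continuous[of "indicator J" snd] assms(2)
    by (simp add: continuous_on_snd continuous_on_id borel_measurable_indicator)
  then have "(\<lambda>q. indicator J (snd q) * f q) \<in> borel_measurable (borel :: ('a \<times> real) measure)"
    using assms(1) by (rule borel_measurable_times)
  then have "(\<lambda>(p, s). indicator J s * f (p, s)) \<in> borel_measurable (borel \<Otimes>\<^sub>M lborel)"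
    unfolding measurable_cong_sets[OF s refl] by (simp add: case_prod_beta')
  then show ?thesis by (rule lborel.borel_measurable_lebesgue_integral)
qed

text \<open>Integrating from -\<infinity> lets one cumulative integral serve both time directions:
  its limits are the whole integral and \<open>0\<close>. In either case the L1 distance to the
  limit is at most the integral of |f| over a region of times that recedes to infinity, which
  vanishes by dominated convergence.\<close>

lemma tail_integral_tendsto:
  fixes f :: "'a::euclidean_space \<times> real \<Rightarrow> real"
  assumes f: "integrable lborel f"
  shows "((\<lambda>t. L1_norm (\<lambda>p. (LINT s|lborel. indicator {..t} s * f (p, s)) - (LINT s|lborel. f (p, s)))) \<longlongrightarrow> 0) at_top"
    and "((\<lambda>t. L1_norm (\<lambda>p. (LINT s|lborel. indicator {..t} s * f (p, s)) - 0)) \<longlongrightarrow> 0) at_bot"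
proof -
  have fm: "f \<in> borel_measurable borel" using borel_measurable_integrable[OF f] by simp
  have indm: "(\<lambda>q. indicator J (snd q) :: real) \<in> borel_measurable (borel :: ('a \<times> real) measure)"
    if "J \<in> sets borel" for J
    using borel_measurable_comp_continuous[of "indicator J" snd] that
    by (simp add: continuous_on_snd continuous_on_id borel_measurable_indicator)
  have sec: "AE p in lborel. integrable lborel (\<lambda>s. f (p, s))"
    using lborel_pair.AE_integrable_fst'[of f] f by (simp add: lborel_prod)
  \<comment> \<open>Only absolute values are compared, since the tail after t enters with the
    opposite sign.\<close>
  have dominated: "L1_norm g \<le> ennreal (LINT q|lborel. indicator J (snd q) * \<bar>f q\<bar>)"
    if J: "J \<in> sets borel"
      and g: "AE p in lborel. \<bar>g p\<bar> = \<bar>LINT s|lborel. indicator J s * f (p, s)\<bar>" for J and g :: "'a \<Rightarrow> real"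
  proof -
    have "L1_norm g = (\<integral>\<^sup>+p. ennreal \<bar>g p\<bar> \<partial>lborel)"
      by (simp add: L1_norm_def nn_integral_completion)
    also have "\<dots> \<le> (\<integral>\<^sup>+p. (\<integral>\<^sup>+s. ennreal (indicator J s * \<bar>f (p, s)\<bar>) \<partial>lborel) \<partial>lborel)"
    proof (rule nn_integral_mono_AE)
      show "AE p in lborel. ennreal \<bar>g p\<bar> \<le> (\<integral>\<^sup>+s. ennreal (indicator J s * \<bar>f (p, s)\<bar>) \<partial>lborel)"
        using g sec
      proof eventually_elim
        case (elim p)
        have "integrable lborel (\<lambda>s. indicator J s * f (p, s))"
          using integrable_mult_indicator[OF _ elim(2), of J] J by simp
        from integral_norm_bound_ennreal[OF this] show ?case
          unfolding elim(1) by (simp add: abs_mult)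
      qed
    qed
    also have "\<dots> = (\<integral>\<^sup>+q. ennreal (indicator J (snd q) * \<bar>f q\<bar>) \<partial>lborel)"
    proof (subst nn_integral_lborel_pair)
      show "(\<lambda>q. ennreal (indicator J (snd q) * \<bar>f q\<bar>)) \<in> borel_measurable borel"
        using indm[OF J] fm by measurable
    qed simp
    also have "\<dots> = ennreal (LINT q|lborel. indicator J (snd q) * \<bar>f q\<bar>)"
    proof (rule nn_integral_eq_integral)
      show "integrable lborel (\<lambda>q. indicator J (snd q) * \<bar>f q\<bar>)"
        by (rule Bochner_Integration.integrable_bound[OF f])
          (use indm[OF J] fm in \<open>auto simp: abs_mult indicator_def\<close>)
    qed auto
    finally show ?thesis .
  qed
  have top: "((\<lambda>t. LINT q|lborel. indicator {t<..} (snd q) * \<bar>f q\<bar>) \<longlongrightarrow> (LINT q|(lborel :: ('a \<times> real) measure). 0)) at_top"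
  proof (rule integral_dominated_convergence_at_top[where w="\<lambda>q. \<bar>f q\<bar>"])
    show "(\<lambda>q. indicator {t<..} (snd q) * \<bar>f q\<bar>) \<in> borel_measurable lborel" for t
      using indm[of "{t<..}"] fm by simp
    show "AE q in lborel. ((\<lambda>t. indicator {t<..} (snd q) * \<bar>f q\<bar>) \<longlongrightarrow> 0) at_top"
    proof (rule AE_I2, rule tendsto_eventually)
      fix q
      show "\<forall>\<^sub>F t in at_top. indicator {t<..} (snd q) * \<bar>f q\<bar> = 0"
        using eventually_ge_at_top[of "snd q"] by eventually_elim (auto simp: indicator_def)
    qed
  qed (use f in \<open>auto simp: indicator_def\<close>)
  \<comment> \<open>Time is reversed because dominated convergence is invoked along
    \<open>at_top\<close>.\<close>
  have bot: "((\<lambda>t. LINT q|lborel. indicator {..-t} (snd q) * \<bar>f q\<bar>) \<longlongrightarrow> (LINT q|(lborel :: ('a \<times> real) measure). 0)) at_top"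
  proof (rule integral_dominated_convergence_at_top[where w="\<lambda>q. \<bar>f q\<bar>"])
    show "(\<lambda>q. indicator {..-t} (snd q) * \<bar>f q\<bar>) \<in> borel_measurable lborel" for t
      using indm[of "{..-t}"] fm by simp
    show "AE q in lborel. ((\<lambda>t. indicator {..-t} (snd q) * \<bar>f q\<bar>) \<longlongrightarrow> 0) at_top"
    proof (rule AE_I2, rule tendsto_eventually)
      fix q
      show "\<forall>\<^sub>F t in at_top. indicator {..-t} (snd q) * \<bar>f q\<bar> = 0"
        using eventually_gt_at_top[of "- snd q"] by eventually_elim (auto simp: indicator_def)
    qed
  qed (use f in \<open>auto simp: indicator_def\<close>)
  show "((\<lambda>t. L1_norm (\<lambda>p. (LINT s|lborel. indicator {..t} s * f (p, s)) - (LINT s|lborel. f (p, s)))) \<longlongrightarrow> 0) at_top"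
  proof (rule tendsto_sandwich[OF _ _ tendsto_const])
    show "\<forall>\<^sub>F t in at_top. L1_norm (\<lambda>p. (LINT s|lborel. indicator {..t} s * f (p, s)) - (LINT s|lborel. f (p, s)))
        \<le> ennreal (LINT q|lborel. indicator {t<..} (snd q) * \<bar>f q\<bar>)"
    proof (rule always_eventually, intro allI dominated)
      fix t
      show "AE p in lborel. \<bar>(LINT s|lborel. indicator {..t} s * f (p, s)) - (LINT s|lborel. f (p, s))\<bar>
          = \<bar>LINT s|lborel. indicator {t<..} s * f (p, s)\<bar>"
        using sec
      proof eventually_elim
        case (elim p)
        have i: "integrable lborel (\<lambda>s. indicator {..t} s * f (p, s))"
          using integrable_mult_indicator[OF _ elim, of "{..t}"] by simp
        have "(LINT s|lborel. indicator {t<..} s * f (p, s))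
            = (LINT s|lborel. f (p, s) - indicator {..t} s * f (p, s))"
          by (rule Bochner_Integration.integral_cong) (auto simp: indicator_def)
        also have "\<dots> = (LINT s|lborel. f (p, s)) - (LINT s|lborel. indicator {..t} s * f (p, s))"
          by (rule Bochner_Integration.integral_diff[OF elim i])
        finally show ?case by (simp add: abs_minus_commute)
      qed
    qed simp
    show "((\<lambda>t. ennreal (LINT q|lborel. indicator {t<..} (snd q) * \<bar>f q\<bar>)) \<longlongrightarrow> 0) at_top"
      using tendsto_ennrealI[OF top] by simp
  qed simp
  show "((\<lambda>t. L1_norm (\<lambda>p. (LINT s|lborel. indicator {..t} s * f (p, s)) - 0)) \<longlongrightarrow> 0) at_bot"
  proof (rule tendsto_sandwich[OF _ _ tendsto_const])
    show "\<forall>\<^sub>F t in at_bot. L1_norm (\<lambda>p. (LINT s|lborel. indicator {..t} s * f (p, s)) - 0)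
        \<le> ennreal (LINT q|lborel. indicator {..t} (snd q) * \<bar>f q\<bar>)"
      by (intro always_eventually allI dominated) auto
    show "((\<lambda>t. ennreal (LINT q|lborel. indicator {..t} (snd q) * \<bar>f q\<bar>)) \<longlongrightarrow> 0) at_bot"
      unfolding at_bot_mirror filterlim_filtermap using tendsto_ennrealI[OF bot] by simp
  qed simp
qed

text \<open>Meant for q the collision integral along one trajectory and h a section of its Borel
  representative. Measurability of q on J comes from completeness of Lebesgue measure.\<close>

lemma set_integral_lebesgue_AE:
  fixes q h :: "real \<Rightarrow> real"
  assumes h: "integrable lborel h" and ae: "AE s in lborel. s \<in> J \<longrightarrow> q s = h s" and J: "J \<in> sets borel"
  shows "set_integrable lebesgue J q" "(LINT s:J|lebesgue. q s) = (LINT s|lborel. indicator J s * h s)"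
proof -
  let ?g = "\<lambda>s. indicator J s * h s"
  have gi: "integrable lborel ?g"
    using integrable_mult_indicator[OF _ h, of J] J by simp
  then have gm: "?g \<in> borel_measurable lborel" by (rule borel_measurable_integrable)
  have e: "AE s in lborel. indicator J s * q s = ?g s"
    using ae by eventually_elim (auto simp: indicator_def)
  have qm: "(\<lambda>s. indicator J s * q s) \<in> borel_measurable lebesgue"
    by (rule borel_measurable_lebesgue_AE[OF measurable_completion[OF gm] e])
  have gi': "integrable lebesgue ?g" using gi gm by (simp add: integrable_completion)
  show "set_integrable lebesgue J q"
    unfolding set_integrable_def using qm measurable_completion[OF gm] AE_completion[OF e] gi'
    by (subst integrable_cong_AE[where g="?g"]) auto
  have "(LINT s:J|lebesgue. q s) = (LINT s|lebesgue. ?g s)"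
    unfolding set_lebesgue_integral_def using qm measurable_completion[OF gm] AE_completion[OF e]
    by (intro integral_cong_AE) auto
  also have "\<dots> = (LINT s|lborel. ?g s)" using gm by (rule integral_completion)
  finally show "(LINT s:J|lebesgue. q s) = (LINT s|lborel. ?g s)" .
qed

lemma interval_integral_cumulative:
  fixes q h :: "real \<Rightarrow> real"
  assumes h: "integrable lborel h" and ae: "AE s in lborel. s \<in> I \<longrightarrow> q s = h s"
    and I: "is_interval I" "t1 \<in> I" "t2 \<in> I"
  shows "(LINT s=t1..t2|lebesgue. q s) = (LINT s|lborel. indicator {..t2} s * h s) - (LINT s|lborel. indicator {..t1} s * h s)"
proof -
  \<comment> \<open>End points in increasing order first; the oriented integral changes sign when
    they are exchanged, and so does the right-hand side.\<close>
  have *: "(LINT s:{a<..<b}|lebesgue. q s) = (LINT s|lborel. indicator {..b} s * h s) - (LINT s|lborel. indicator {..a} s * h s)"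
    if "a \<le> b" "a \<in> I" "b \<in> I" for a b
  proof -
    have "{a<..<b} \<subseteq> I" by (auto intro: mem_is_interval_1_I[OF I(1) that(2,3)])
    with ae have "AE s in lborel. s \<in> {a<..<b} \<longrightarrow> q s = h s" by (auto elim!: eventually_mono)
    from set_integral_lebesgue_AE(2)[OF h this]
    have "(LINT s:{a<..<b}|lebesgue. q s) = (LINT s|lborel. indicator {a<..<b} s * h s)" by simp
    also have "\<dots> = (LINT s|lborel. indicator {..b} s * h s - indicator {..a} s * h s)"
    proof (rule integral_cong_AE)
      show "AE s in lborel. indicator {a<..<b} s * h s = indicator {..b} s * h s - indicator {..a} s * h s"
        \<comment> \<open>The indicators differ by that of \<open>{a<..b}\<close>, whereas the
          interval integral runs over the open interval; the end point \<open>b\<close> is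
          discarded.\<close>
        using AE_lborel_singleton[of b] by eventually_elim (use that in \<open>auto simp: indicator_def\<close>)
    qed (use borel_measurable_integrable[OF h] in auto)
    also have "\<dots> = (LINT s|lborel. indicator {..b} s * h s) - (LINT s|lborel. indicator {..a} s * h s)"
      using integrable_mult_indicator[OF _ h, of "{..b}"] integrable_mult_indicator[OF _ h, of "{..a}"]
      by (intro Bochner_Integration.integral_diff) simp_all
    finally show ?thesis .
  qed
  show ?thesis
    using *[of t1 t2] *[of t2 t1] I by (simp add: interval_lebesgue_integral_def)
qed

text \<open>\<open>u t - \<Phi> t\<close> is a.e. independent of t, so u converges exactly as \<Phi>
  does. The exceptional set may vary with t, as each L1 norm concerns a single time.\<close>

lemma L1_limit_shift:
  fixes u \<Phi> :: "real \<Rightarrow> 'a::euclidean_space \<Rightarrow> real"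
  assumes \<F>: "eventually (\<lambda>t. t \<in> I) \<F>"
    and u\<Phi>: "\<And>t. t \<in> I \<Longrightarrow> AE p in lborel. u t p = u t1 p + (\<Phi> t p - \<Phi> t1 p)"
    and lim: "((\<lambda>t. L1_norm (\<lambda>p. \<Phi> t p - L p)) \<longlongrightarrow> 0) \<F>"
  shows "((\<lambda>t. L1_norm (\<lambda>p. u t p - (u t1 p - \<Phi> t1 p + L p))) \<longlongrightarrow> 0) \<F>"
proof (rule Lim_transform_eventually[OF lim])
  show "\<forall>\<^sub>F t in \<F>. L1_norm (\<lambda>p. \<Phi> t p - L p) = L1_norm (\<lambda>p. u t p - (u t1 p - \<Phi> t1 p + L p))"
    using \<F>
  proof eventually_elim
    case (elim t)
    show ?case
      unfolding L1_norm_def nn_integral_completion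
      by (rule nn_integral_cong_AE) (use u\<Phi>[OF elim] in \<open>auto elim!: eventually_mono\<close>)
  qed
qed

lemma L1_limit_unique:
  fixes u :: "'t \<Rightarrow> 'a::euclidean_space \<Rightarrow> real"
  assumes "\<F> \<noteq> bot" and u: "eventually (\<lambda>t. u t \<in> borel_measurable lebesgue) \<F>"
    and G: "G \<in> borel_measurable lebesgue" "((\<lambda>t. L1_norm (\<lambda>p. u t p - G p)) \<longlongrightarrow> 0) \<F>"
    and H: "H \<in> borel_measurable lebesgue" "((\<lambda>t. L1_norm (\<lambda>p. u t p - H p)) \<longlongrightarrow> 0) \<F>"
  shows "AE p in lebesgue. H p = G p"
proof -
  have "((\<lambda>t. L1_norm (\<lambda>p. u t p - H p) + L1_norm (\<lambda>p. u t p - G p)) \<longlongrightarrow> 0 + 0) \<F>"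
    by (rule tendsto_add[OF H(2) G(2)])
  moreover have "\<forall>\<^sub>F t in \<F>. L1_norm (\<lambda>p. H p - G p) \<le> L1_norm (\<lambda>p. u t p - H p) + L1_norm (\<lambda>p. u t p - G p)"
    using u
  proof eventually_elim
    case (elim t)
    have "L1_norm (\<lambda>p. H p - G p) \<le> (\<integral>\<^sup>+p. ennreal \<bar>u t p - H p\<bar> + ennreal \<bar>u t p - G p\<bar> \<partial>lebesgue)"
      unfolding L1_norm_def by (intro nn_integral_mono) (simp add: ennreal_plus[symmetric] ennreal_leI del: ennreal_plus)
    also have "\<dots> = L1_norm (\<lambda>p. u t p - H p) + L1_norm (\<lambda>p. u t p - G p)"
    proof -
      have [measurable]: "u t \<in> borel_measurable lebesgue" "G \<in> borel_measurable lebesgue"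
        "H \<in> borel_measurable lebesgue"
        using elim G H by auto
      show ?thesis unfolding L1_norm_def by (intro nn_integral_add) measurable
    qed
    finally show ?case .
  qed
  ultimately have "L1_norm (\<lambda>p. H p - G p) \<le> 0 + 0"
    using assms(1) by (intro tendsto_lowerbound)
  then have "(\<integral>\<^sup>+p. ennreal \<bar>H p - G p\<bar> \<partial>lebesgue) = 0" by (simp add: L1_norm_def)
  then have "AE p in lebesgue. ennreal \<bar>H p - G p\<bar> = 0"
    using G H by (subst (asm) nn_integral_0_iff_AE) auto
  then show ?thesis by (auto elim!: eventually_mono simp: ennreal_eq_0_iff)
qed

text \<open>By Fatou's lemma the lower limit of |u n p - G p| is zero for almost every p, so no
  subsequence has to be extracted. The majorants may vary with n; only their pointwise limits are
  compared with \<open>b\<close>.\<close>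

lemma L1_limit_bound:
  fixes u m :: "nat \<Rightarrow> 'a::euclidean_space \<Rightarrow> real"
  assumes u: "\<And>n. u n \<in> borel_measurable lebesgue" and G: "G \<in> borel_measurable lebesgue"
    and lim: "(\<lambda>n. L1_norm (\<lambda>p. u n p - G p)) \<longlonglongrightarrow> 0"
    and le: "\<And>n. AE p in lebesgue. \<bar>u n p\<bar> \<le> m n p"
    and m: "\<And>p. \<exists>l. (\<lambda>n. m n p) \<longlonglongrightarrow> l \<and> l \<le> b p"
  shows "AE p in lebesgue. \<bar>G p\<bar> \<le> b p"
proof -
  let ?d = "\<lambda>n p. ennreal \<bar>u n p - G p\<bar>"
  have "(\<integral>\<^sup>+p. liminf (\<lambda>n. ?d n p) \<partial>lebesgue) \<le> liminf (\<lambda>n. \<integral>\<^sup>+p. ?d n p \<partial>lebesgue)"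
    using u G by (intro nn_integral_liminf) measurable
  also have "\<dots> = 0"
    using lim unfolding L1_norm_def by (intro lim_imp_Liminf) auto
  finally have "AE p in lebesgue. liminf (\<lambda>n. ?d n p) = 0"
    using u G by (subst (asm) le_zero_eq, subst (asm) nn_integral_0_iff_AE) (measurable, auto)
  moreover have "AE p in lebesgue. \<forall>n. \<bar>u n p\<bar> \<le> m n p"
    using le by (simp add: AE_all_countable)
  ultimately show ?thesis
  proof eventually_elim
    case (elim p)
    obtain l where l: "(\<lambda>n. m n p) \<longlonglongrightarrow> l" "l \<le> b p" using m by blast
    show ?case
    proof (rule ccontr)
      assume "\<not> \<bar>G p\<bar> \<le> b p"
      \<comment> \<open>Half the gap between |G p| and the limit of the majorants: once
        \<open>m n p\<close> is below l + \<epsilon>, \<open>u n p\<close> stays at distance at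
        least \<epsilon> from \<open>G p\<close>.\<close>
      define \<epsilon> where "\<epsilon> = (\<bar>G p\<bar> - l) / 2"
      have \<epsilon>: "0 < \<epsilon>" using \<open>\<not> _\<close> l(2) by (simp add: \<epsilon>_def)
      have "\<forall>\<^sub>F n in sequentially. m n p < l + \<epsilon>"
        using l(1) \<epsilon> by (intro order_tendstoD(2)) auto
      then have "\<forall>\<^sub>F n in sequentially. ennreal \<epsilon> \<le> ?d n p"
      proof eventually_elim
        case (elim n)
        have "\<bar>u n p\<bar> \<le> m n p" using \<open>\<forall>n. \<bar>u n p\<bar> \<le> m n p\<close> ..
        moreover have "\<bar>G p\<bar> \<le> \<bar>u n p\<bar> + \<bar>u n p - G p\<bar>" by linarith
        ultimately have "\<epsilon> \<le> \<bar>u n p - G p\<bar>" using elim by (simp add: \<epsilon>_def field_simps)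
        then show ?case by (rule ennreal_leI)
      qed
      then have "ennreal \<epsilon> \<le> liminf (\<lambda>n. ?d n p)" by (rule Liminf_bounded)
      with elim(1) \<epsilon> show False by simp
    qed
  qed
qed

section \<open>Asymptotic states\<close>

text \<open>Coercivity of the exponent bounds |M| by |A| times the isotropic streaming Gaussian
  \<open>E\<close>, which reduces the claim to the explicit pair integral.\<close>

lemma maxwellian_collision_majorant:
  fixes M :: "(real ^ 'n) \<times> (real ^ 'n) \<times> real \<Rightarrow> real"
  assumes "global_maxwellian M" and \<beta>: "1 - real CARD('n) < \<beta>" and C: "C < (\<infinity>::ennreal)"
  shows "(\<lambda>(v, x, t). \<integral>\<^sup>+w. 2 * C * ennreal (M (v, x, t) * M (w, x, t) * norm (v - w) powr \<beta>) \<partial>lborel)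
      \<in> borel_measurable borel" (is "?H \<in> _")
    and "(\<integral>\<^sup>+(v, x, t). (\<integral>\<^sup>+w. 2 * C * ennreal (M (v, x, t) * M (w, x, t) * norm (v - w) powr \<beta>) \<partial>lborel) \<partial>lborel) < \<infinity>"
proof -
  obtain A q v0 x0 \<delta> where sg: "streaming_gaussian M A q v0 x0 \<delta>"
    using global_maxwellian_gaussian[OF assms(1)] by blast
  then have M: "M = (\<lambda>(v, x, t). A * exp (- q (v - v0) (x - x0 - t *\<^sub>R (v - v0))))"
    and cont: "continuous_on UNIV (\<lambda>p. q (fst p) (snd p))"
    and \<delta>: "0 < \<delta>" "\<And>v y. \<delta> * ((norm v)\<^sup>2 + (norm y)\<^sup>2) \<le> q v y"
    unfolding streaming_gaussian_def by blast+
  define E where "E = (\<lambda>(v, x, t). exp (- \<delta> * ((norm (v - v0))\<^sup>2 + (norm (x - x0 - t *\<^sub>R (v - v0)))\<^sup>2)))"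
  have ME: "\<bar>M p\<bar> \<le> \<bar>A\<bar> * E p" for p
    using \<delta>(2) by (auto simp: M E_def abs_mult split: prod.split intro!: mult_left_mono)
  let ?e = "\<lambda>p w. ennreal (E p * E (w, snd p) * norm (fst p - w) powr \<beta>)"
  let ?m = "\<lambda>p w. 2 * C * ennreal (M p * M (w, snd p) * norm (fst p - w) powr \<beta>)"
  have \<beta>': "1 - real DIM(real ^ 'n) < \<beta>" using \<beta> by simp
  note fin = streaming_gauss_pair_integral_finite[OF \<delta>(1) \<beta>', of v0 x0, folded E_def]
  have em: "(\<lambda>(p, w). ?e p w) \<in> borel_measurable borel"
    using fin(1) by (simp add: case_prod_beta')
  have le: "?m p w \<le> (2 * C * ennreal (\<bar>A\<bar> * \<bar>A\<bar>)) * ?e p w" for p w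
  proof -
    have "M p * M (w, snd p) \<le> \<bar>M p\<bar> * \<bar>M (w, snd p)\<bar>" by (simp add: abs_mult[symmetric])
    also have "\<dots> \<le> (\<bar>A\<bar> * E p) * (\<bar>A\<bar> * E (w, snd p))"
      by (intro mult_mono ME) (auto intro: order_trans[OF abs_ge_zero ME])
    finally have "M p * M (w, snd p) * norm (fst p - w) powr \<beta>
        \<le> \<bar>A\<bar> * E p * (\<bar>A\<bar> * E (w, snd p)) * norm (fst p - w) powr \<beta>"
      by (rule mult_right_mono) simp
    also have "\<dots> = (\<bar>A\<bar> * \<bar>A\<bar>) * (E p * E (w, snd p) * norm (fst p - w) powr \<beta>)"
      by (simp only: mult_ac)
    finally have "ennreal (M p * M (w, snd p) * norm (fst p - w) powr \<beta>)
        \<le> ennreal ((\<bar>A\<bar> * \<bar>A\<bar>) * (E p * E (w, snd p) * norm (fst p - w) powr \<beta>))"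
      by (rule ennreal_leI)
    also have "\<dots> = ennreal (\<bar>A\<bar> * \<bar>A\<bar>) * ?e p w"
      by (rule ennreal_mult') simp
    finally show ?thesis
      unfolding mult.assoc[of "2 * C"] by (rule mult_left_mono) simp
  qed
  have Mm: "M \<in> borel_measurable borel"
  proof -
    have "continuous_on UNIV M"
      unfolding M case_prod_beta'
      using continuous_on_compose2[OF cont, of UNIV "\<lambda>p. (fst p - v0, fst (snd p) - x0 - snd (snd p) *\<^sub>R (fst p - v0))"]
      by (simp add: continuous_intros)
    then show ?thesis by (rule borel_measurable_continuous_onI)
  qed
  have mm: "(\<lambda>(p, w). ?m p w) \<in> borel_measurable borel"
  proof -
    have 1: "(\<lambda>r. M (fst r)) \<in> borel_measurable (borel :: (((real ^ 'n) \<times> (real ^ 'n) \<times> real) \<times> (real ^ 'n)) measure)"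
      by (rule borel_measurable_comp_continuous[OF Mm]) (intro continuous_intros)
    have 2: "(\<lambda>r. M (snd r, snd (fst r))) \<in> borel_measurable (borel :: (((real ^ 'n) \<times> (real ^ 'n) \<times> real) \<times> (real ^ 'n)) measure)"
      by (rule borel_measurable_comp_continuous[OF Mm]) (intro continuous_intros)
    have "(\<lambda>r. norm (fst (fst r) - snd r)) \<in> borel_measurable (borel :: (((real ^ 'n) \<times> (real ^ 'n) \<times> real) \<times> (real ^ 'n)) measure)"
      by (intro borel_measurable_continuous_onI continuous_intros)
    then have 3: "(\<lambda>r. norm (fst (fst r) - snd r) powr \<beta>) \<in> borel_measurable (borel :: (((real ^ 'n) \<times> (real ^ 'n) \<times> real) \<times> (real ^ 'n)) measure)"
      by measurable
    show ?thesis
      unfolding case_prod_beta' using 1 2 3 by measurable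
  qed
  have "(\<lambda>p. \<integral>\<^sup>+w. ?m p w \<partial>lborel) \<in> borel_measurable borel"
    using mm by (rule borel_measurable_nn_integral_lborel)
  then show "?H \<in> borel_measurable borel" by (simp add: case_prod_beta')
  have "(\<integral>\<^sup>+p. (\<integral>\<^sup>+w. ?m p w \<partial>lborel) \<partial>lborel)
      \<le> (\<integral>\<^sup>+p. (\<integral>\<^sup>+w. (2 * C * ennreal (\<bar>A\<bar> * \<bar>A\<bar>)) * ?e p w \<partial>lborel) \<partial>lborel)"
    by (intro nn_integral_mono le)
  also have "\<dots> = (\<integral>\<^sup>+p. (2 * C * ennreal (\<bar>A\<bar> * \<bar>A\<bar>)) * (\<integral>\<^sup>+w. ?e p w \<partial>lborel) \<partial>lborel)"
  proof (rule nn_integral_cong, rule nn_integral_cmult)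
    fix p :: "(real ^ 'n) \<times> (real ^ 'n) \<times> real"
    show "?e p \<in> borel_measurable lborel"
      using borel_measurable_comp_continuous[OF em, of "\<lambda>w. (p, w)"] by (simp add: continuous_intros)
  qed
  also have "\<dots> = (2 * C * ennreal (\<bar>A\<bar> * \<bar>A\<bar>)) * (\<integral>\<^sup>+p. (\<integral>\<^sup>+w. ?e p w \<partial>lborel) \<partial>lborel)"
    using borel_measurable_nn_integral_lborel[OF em] by (intro nn_integral_cmult) simp
  also have "\<dots> < \<infinity>"
    using fin(2) C by (simp add: case_prod_beta' ennreal_mult_less_top)
  finally show "(\<integral>\<^sup>+(v, x, t). (\<integral>\<^sup>+w. 2 * C * ennreal (M (v, x, t) * M (w, x, t) * norm (v - w) powr \<beta>) \<partial>lborel) \<partial>lborel) < \<infinity>"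
    by (simp add: case_prod_beta')
qed

text \<open>With the parametrisation in \<^const>\<open>global_maxwellian\<close>, \<open>M\<close> is constant along free streaming only
  if \<open>v0 = 0\<close>; otherwise it tends to \<open>0\<close>, so the limit is still at most \<open>M (v, x, 0)\<close>.\<close>

lemma maxwellian_stream_limit:
  fixes M :: "(real ^ 'n) \<times> (real ^ 'n) \<times> real \<Rightarrow> real" and \<tau> :: "nat \<Rightarrow> real"
  assumes "global_maxwellian M" and \<tau>: "filterlim \<tau> at_infinity sequentially"
    and nn: "\<exists>p. 0 \<le> M p"
  shows "\<exists>l. (\<lambda>n. M (stream (p, \<tau> n))) \<longlonglongrightarrow> l \<and> l \<le> M (fst p, snd p, 0)"
proof -
  obtain A q v0 x0 \<delta> where sg: "streaming_gaussian M A q v0 x0 \<delta>"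
    using global_maxwellian_gaussian[OF assms(1)] by blast
  then have M: "M = (\<lambda>(v, x, t). A * exp (- q (v - v0) (x - x0 - t *\<^sub>R (v - v0))))"
    and \<delta>: "0 < \<delta>" "\<And>v y. \<delta> * ((norm v)\<^sup>2 + (norm y)\<^sup>2) \<le> q v y"
    unfolding streaming_gaussian_def by blast+
  obtain v x where p: "p = (v, x)" by (cases p)
  \<comment> \<open>The exponential is positive, so one point with M \<ge> 0 decides the sign of the
    amplitude.\<close>
  have A: "0 \<le> A" using nn by (auto simp: M zero_le_mult_iff)
  \<comment> \<open>In the moving frame x + t v - x0 - t (v - v0) is x - x0 + t v0, so time survives
    only through the drift t v0.\<close>
  have Ms: "M (stream (p, t)) = A * exp (- q (v - v0) (x - x0 + t *\<^sub>R v0))" for t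
    by (simp add: M p stream_def algebra_simps)
  show ?thesis
  proof (cases "v0 = 0")
    case True
    have "M (stream (p, t)) = M (fst p, snd p, 0)" for t
      unfolding Ms using True by (simp add: M p)
    then show ?thesis by (intro exI[of _ "M (fst p, snd p, 0)"]) simp
  next
    case False
    have "filterlim (\<lambda>n. \<tau> n *\<^sub>R v0) at_infinity sequentially"
    proof -
      have "filterlim (\<lambda>n. norm (\<tau> n) * norm v0) at_top sequentially"
        using filterlim_at_infinity_imp_norm_at_top[OF \<tau>] False
        by (intro filterlim_at_top_mult_tendsto_pos[OF tendsto_const]) auto
      then show ?thesis
        by (intro filterlim_norm_at_top_imp_at_infinity) simp
    qed
    then have "filterlim (\<lambda>n. (x - x0) + \<tau> n *\<^sub>R v0) at_infinity sequentially"
      by (rule tendsto_add_filterlim_at_infinity[OF tendsto_const])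
    then have "filterlim (\<lambda>n. norm (x - x0 + \<tau> n *\<^sub>R v0)) at_top sequentially"
      by (rule filterlim_at_infinity_imp_norm_at_top)
    then have "filterlim (\<lambda>n. \<delta> * (norm (x - x0 + \<tau> n *\<^sub>R v0))\<^sup>2) at_top sequentially"
      using \<delta>(1) by (intro filterlim_tendsto_pos_mult_at_top[OF tendsto_const] filterlim_pow_at_top) auto
    then have "filterlim (\<lambda>n. q (v - v0) (x - x0 + \<tau> n *\<^sub>R v0)) at_top sequentially"
    proof (rule filterlim_at_top_mono, intro always_eventually allI)
      fix n
      show "\<delta> * (norm (x - x0 + \<tau> n *\<^sub>R v0))\<^sup>2 \<le> q (v - v0) (x - x0 + \<tau> n *\<^sub>R v0)"
        using \<delta>(1) by (intro order_trans[OF _ \<delta>(2)]) (simp add: distrib_left)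
    qed
    then have "(\<lambda>n. exp (- q (v - v0) (x - x0 + \<tau> n *\<^sub>R v0))) \<longlonglongrightarrow> 0"
      by (intro filterlim_compose[OF exp_at_bot]) (simp add: filterlim_uminus_at_bot)
    from tendsto_mult_left[OF this, of A] have "(\<lambda>n. M (stream (p, \<tau> n))) \<longlonglongrightarrow> 0"
      by (simp add: Ms)
    moreover have "0 \<le> M (fst p, snd p, 0)" using A by (simp add: M p)
    ultimately show ?thesis by blast
  qed
qed

lemma transport_at_time: "transport t (at_time F t) p = F (stream (p, t))"
  by (simp add: transport_def at_time_def stream_def case_prod_beta')

text \<open>Free transport is an isometry of L1, so convergence to a free solution is convergence to
  a fixed function in the moving frame.\<close>

lemma L1_norm_at_time_transport:
  fixes F :: "(real ^ 'n) \<times> (real ^ 'n) \<times> real \<Rightarrow> real"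
  assumes u: "(\<lambda>p. F (stream (p, t))) \<in> borel_measurable lebesgue" and G: "G \<in> borel_measurable lebesgue"
  shows "L1_norm (\<lambda>p. at_time F t p - transport (- t) G p) = L1_norm (\<lambda>p. F (stream (p, t)) - G p)"
proof -
  have "(\<lambda>p. at_time F t p - transport (- t) G p) = transport (- t) (\<lambda>p. F (stream (p, t)) - G p)"
    by (simp add: fun_eq_iff transport_def at_time_def stream_def)
  moreover have "(\<lambda>p. F (stream (p, t)) - G p) \<in> borel_measurable lebesgue"
    using u G by (rule borel_measurable_diff)
  ultimately show ?thesis by (simp add: L1_norm_transport)
qed

text \<open>\<open>f\<close> is a Borel representative of the collision integral in the moving
  frame, a.e. zero at times outside I. The majorant makes it integrable over all phase points and
  times, so its cumulative integrals from -\<infinity> exist. By Fubini the representation holds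
  along almost every trajectory, with an exceptional set of trajectories that serves all pairs of
  times in the Duhamel formula.\<close>

lemma mild_solution_cumulative:
  fixes k :: "real ^ 'n \<Rightarrow> real ^ 'n \<Rightarrow> real" and F M :: "(real ^ 'n) \<times> (real ^ 'n) \<times> real \<Rightarrow> real"
  assumes k: "separated_kernel \<beta> k" "1 - real CARD('n) < \<beta>" and M: "global_maxwellian M"
    and I: "open I" "is_interval I"
    and F: "mild_solution k I F"
    and FM: "AE (v, x, t) in lborel. t \<in> I \<longrightarrow> \<bar>F (v, x, t)\<bar> \<le> M (v, x, t)"
  obtains f :: "((real ^ 'n) \<times> (real ^ 'n)) \<times> real \<Rightarrow> real" where "integrable lborel f"
    and "AE p in lborel. integrable lborel (\<lambda>s. f (p, s)) \<and>
      (AE s in lborel. s \<in> I \<longrightarrow> transport s (at_time (collision k F) s) p = f (p, s))"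
    and "\<forall>t1\<in>I. \<forall>t2\<in>I. AE p in lborel. F (stream (p, t2)) = F (stream (p, t1))
      + ((LINT s|lborel. indicator {..t2} s * f (p, s)) - (LINT s|lborel. indicator {..t1} s * f (p, s)))"
proof -
  let ?Q = "collision k F"
  let ?S = "UNIV \<times> UNIV \<times> I :: ((real ^ 'n) \<times> (real ^ 'n) \<times> real) set"
  define Q1 where "Q1 = (\<lambda>q. indicator ?S q * ?Q q)"
  have S: "open ?S" using I(1) by (intro open_Times) auto
  have L: "L1_loc ?S ?Q" using F by (simp add: mild_solution_def)
  have Q1m: "Q1 \<in> borel_measurable lebesgue"
    unfolding Q1_def by (rule L1_loc_measurable[OF S L])
  obtain C :: ennreal where C: "C < \<infinity>" "\<And>z. z \<noteq> 0 \<Longrightarrow> k z \<in> borel_measurable (completion sphere_measure)"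
    "\<And>z \<omega>. z \<noteq> 0 \<Longrightarrow> norm \<omega> = 1 \<Longrightarrow> 0 \<le> k z \<omega>"
    "\<And>z. z \<noteq> 0 \<Longrightarrow> (\<integral>\<^sup>+\<omega>. ennreal (k z \<omega>) \<partial>sphere_measure) = C * ennreal (norm z powr \<beta>)"
    using separated_kernel_bound[OF k(1)] by blast
  have MM: "M (post1 v w \<omega>, x, t) * M (post2 v w \<omega>, x, t) = M (v, x, t) * M (w, x, t)"
    if "norm \<omega> = 1" for v w x \<omega> :: "real ^ 'n" and t
    by (rule global_maxwellian_collision[OF M that])
  let ?H = "\<lambda>(v, x, t). \<integral>\<^sup>+w. 2 * C * ennreal (M (v, x, t) * M (w, x, t) * norm (v - w) powr \<beta>) \<partial>lborel"
  have "AE q in lborel. ennreal \<bar>Q1 q\<bar> \<le> ?H q"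
  proof -
    have "AE (v, x, t) in lborel. t \<in> I \<longrightarrow> ennreal \<bar>collision k F (v, x, t)\<bar> \<le> ?H (v, x, t)"
      unfolding prod.case
      by (rule collision_bound[where k=k and F=F and M=M and C=C and \<beta>=\<beta> and I=I])
        (fact C(2) C(3) C(4) MM FM)+
    then show ?thesis
      by eventually_elim (auto simp: Q1_def indicator_def)
  qed
  then have "(\<integral>\<^sup>+q. ennreal \<bar>Q1 q\<bar> \<partial>lborel) \<le> (\<integral>\<^sup>+q. ?H q \<partial>lborel)"
    by (rule nn_integral_mono_AE)
  also have "\<dots> < \<infinity>"
    by (rule maxwellian_collision_majorant(2)[OF M k(2) C(1)])
  finally have Q1fin: "(\<integral>\<^sup>+q. ennreal \<bar>Q1 q\<bar> \<partial>lborel) < \<infinity>" .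
  have Qsm: "(\<lambda>q. Q1 (stream q)) \<in> borel_measurable lebesgue"
    by (rule preserves_lborel_measurable[OF preserves_lborel_stream Q1m])
  obtain f where f: "f \<in> borel_measurable borel" and ae: "AE q in lborel. Q1 (stream q) = f q"
    using completion_ex_borel_measurable_real[OF Qsm] by auto
  have "(\<integral>\<^sup>+q. ennreal \<bar>f q\<bar> \<partial>lborel) = (\<integral>\<^sup>+q. ennreal \<bar>Q1 (stream q)\<bar> \<partial>lborel)"
    using ae by (intro nn_integral_cong_AE) (auto elim!: eventually_mono)
  also have "\<dots> = (\<integral>\<^sup>+q. ennreal \<bar>Q1 q\<bar> \<partial>lborel)"
    using Q1m by (intro preserves_lborel_nn_integral[OF preserves_lborel_stream, of "\<lambda>q. ennreal \<bar>Q1 q\<bar>"]) measurable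
  finally have fi: "integrable lborel f"
    using f Q1fin by (intro integrableI_bounded) simp_all
  have sec: "AE p in lborel. integrable lborel (\<lambda>s. f (p, s))"
    using lborel_pair.AE_integrable_fst'[of f] fi by (simp add: lborel_prod)
  have rep: "AE p in lborel. integrable lborel (\<lambda>s. f (p, s)) \<and>
      (AE s in lborel. s \<in> I \<longrightarrow> transport s (at_time ?Q s) p = f (p, s))"
    using AE_lborel_pair[OF ae] sec
  proof eventually_elim
    case (elim p)
    from elim(1) have "AE s in lborel. s \<in> I \<longrightarrow> transport s (at_time ?Q s) p = f (p, s)"
    proof eventually_elim
      case (elim s)
      then show ?case
        by (auto simp: transport_at_time Q1_def stream_def indicator_def split: prod.splits)
    qed
    with elim(2) show ?case by simp
  qed
  show thesis
  proof (rule that[OF fi rep], intro ballI)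
    fix t1 t2 assume t: "t1 \<in> I" "t2 \<in> I"
    have "AE p in lborel. transport t2 (at_time F t2) p = transport t1 (at_time F t1) p
          + (LINT s=t1..t2|lebesgue. transport s (at_time ?Q s) p)"
      using F t by (simp add: mild_solution_def AE_completion_iff)
    then show "AE p in lborel. F (stream (p, t2)) = F (stream (p, t1))
      + ((LINT s|lborel. indicator {..t2} s * f (p, s)) - (LINT s|lborel. indicator {..t1} s * f (p, s)))"
      using rep
    proof eventually_elim
      case (elim p)
      then show ?case
        using interval_integral_cumulative[OF _ _ I(2) t] by (simp add: transport_at_time)
    qed
  qed
qed

text \<open>Both time directions at once: the filter is \<open>at_top\<close> or
  \<open>at_bot\<close>, and L is the limit of the cumulative integral along it. \<open>seq\<close>
  supplies times in I that run to infinity and avoid a given null set of times; this is needed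
  because Fubini gives the bound by \<open>M\<close> and measurability of F(t) only at almost every
  time.\<close>

lemma mild_solution_scattering:
  fixes k :: "real ^ 'n \<Rightarrow> real ^ 'n \<Rightarrow> real" and F M :: "(real ^ 'n) \<times> (real ^ 'n) \<times> real \<Rightarrow> real"
  assumes M: "global_maxwellian M" and I: "open I"
    and F: "L1_loc (UNIV \<times> UNIV \<times> I) F"
    and FM: "AE (v, x, t) in lborel. t \<in> I \<longrightarrow> \<bar>F (v, x, t)\<bar> \<le> M (v, x, t)"
    and f: "integrable lborel f"
    and Ff: "\<forall>t1\<in>I. \<forall>t2\<in>I. AE p in lborel. F (stream (p, t2)) = F (stream (p, t1))
      + ((LINT s|lborel. indicator {..t2} s * f (p, s)) - (LINT s|lborel. indicator {..t1} s * f (p, s)))"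
    and \<F>: "\<F> \<noteq> bot" "eventually (\<lambda>t. t \<in> I) \<F>" and t1: "t1 \<in> I"
    and L: "L \<in> borel_measurable borel"
      "((\<lambda>t. L1_norm (\<lambda>p. (LINT s|lborel. indicator {..t} s * f (p, s)) - L p)) \<longlongrightarrow> 0) \<F>"
    and seq: "\<forall>P. (AE t in lborel. P t) \<longrightarrow>
      (\<exists>\<tau>. filterlim \<tau> \<F> sequentially \<and> filterlim \<tau> at_infinity sequentially \<and> (\<forall>n::nat. \<tau> n \<in> I \<and> P (\<tau> n)))"
    and G_def: "G = (\<lambda>p. F (stream (p, t1)) - (LINT s|lborel. indicator {..t1} s * f (p, s)) + L p)"
  shows "asymptotic_state \<F> F G"
    and "\<And>H. asymptotic_state \<F> F H \<Longrightarrow> AE p in lebesgue. H p = G p"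
    and "AE (v, x) in lebesgue. \<bar>G (v, x)\<bar> \<le> M (v, x, 0)"
proof -
  let ?\<Phi> = "\<lambda>t p. LINT s|lborel. indicator {..t} s * f (p, s)"
  let ?u = "\<lambda>t p. F (stream (p, t))"
  have \<Phi>m: "?\<Phi> t \<in> borel_measurable borel" for t
    by (rule borel_measurable_cumulative) (use borel_measurable_integrable[OF f] in auto)
  let ?S = "UNIV \<times> UNIV \<times> I :: ((real ^ 'n) \<times> (real ^ 'n) \<times> real) set"
  have "open ?S" using I by (intro open_Times) auto
  from L1_loc_measurable[OF this F]
  have "(\<lambda>q. indicator ?S (stream q) * F (stream q)) \<in> borel_measurable lebesgue"
    by (rule preserves_lborel_measurable[OF preserves_lborel_stream])
  then obtain g where g: "g \<in> borel_measurable borel"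
    and ae: "AE q in lborel. indicator ?S (stream q) * F (stream q) = g q"
    using completion_ex_borel_measurable_real by fastforce
  have good1: "AE t in lborel. AE p in lborel. t \<in> I \<longrightarrow> ?u t p = g (p, t)"
    using AE_lborel_pair_swap[OF ae]
    by (auto elim!: eventually_mono simp: stream_def indicator_def split: prod.splits)
  have good2: "AE t in lborel. AE p in lborel. t \<in> I \<longrightarrow> \<bar>?u t p\<bar> \<le> M (stream (p, t))"
    using AE_lborel_pair_swap[OF preserves_lborel_AE[OF preserves_lborel_stream FM]]
    by (auto elim!: eventually_mono simp: stream_def split: prod.splits)
  have "AE t in lborel. (AE p in lborel. t \<in> I \<longrightarrow> ?u t p = g (p, t)) \<and>
      (AE p in lborel. t \<in> I \<longrightarrow> \<bar>?u t p\<bar> \<le> M (stream (p, t)))"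
    using good1 good2 by eventually_elim simp
  from seq[rule_format, OF this] obtain \<tau> where \<tau>: "filterlim \<tau> \<F> sequentially" "filterlim \<tau> at_infinity sequentially"
    "\<And>n::nat. \<tau> n \<in> I" "\<And>n. AE p in lborel. ?u (\<tau> n) p = g (p, \<tau> n)"
    "\<And>n. AE p in lborel. \<bar>?u (\<tau> n) p\<bar> \<le> M (stream (p, \<tau> n))"
    by auto
  \<comment> \<open>Measurability at one good time comes from the Borel representative g; the
    Duhamel formula carries it to every time in I.\<close>
  have um: "?u t \<in> borel_measurable lebesgue" if t: "t \<in> I" for t
  proof (rule borel_measurable_lebesgue_AE)
    have "(\<lambda>p. g (p, \<tau> 0)) \<in> borel_measurable borel"
      by (rule borel_measurable_comp_continuous[OF g]) (intro continuous_intros)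
    then have "(\<lambda>p. g (p, \<tau> 0) + (?\<Phi> t p - ?\<Phi> (\<tau> 0) p)) \<in> borel_measurable borel"
      using \<Phi>m by (intro borel_measurable_add borel_measurable_diff)
    then show "(\<lambda>p. g (p, \<tau> 0) + (?\<Phi> t p - ?\<Phi> (\<tau> 0) p)) \<in> borel_measurable lebesgue"
      by (intro measurable_completion) simp
    show "AE p in lborel. ?u t p = g (p, \<tau> 0) + (?\<Phi> t p - ?\<Phi> (\<tau> 0) p)"
      using \<tau>(4)[of 0] Ff[rule_format, OF \<tau>(3)[of 0] t] by eventually_elim simp
  qed
  have Lm: "L \<in> borel_measurable lebesgue" "?\<Phi> t1 \<in> borel_measurable lebesgue"
    using L(1) \<Phi>m by (auto intro!: measurable_completion)
  then have Gm: "G \<in> borel_measurable lebesgue"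
    unfolding G_def using um[OF t1] by (intro borel_measurable_add borel_measurable_diff)
  have lim: "((\<lambda>t. L1_norm (\<lambda>p. ?u t p - G p)) \<longlongrightarrow> 0) \<F>"
    unfolding G_def by (rule L1_limit_shift[OF \<F>(2) _ L(2)]) (rule Ff[rule_format, OF t1])
  have norm_eq: "\<forall>\<^sub>F t in \<F>. L1_norm (\<lambda>p. at_time F t p - transport (- t) H p) = L1_norm (\<lambda>p. ?u t p - H p)"
    if "H \<in> borel_measurable lebesgue" for H
    using \<F>(2) by eventually_elim (rule L1_norm_at_time_transport[OF um that])
  show "asymptotic_state \<F> F G"
    unfolding asymptotic_state_def using Gm lim tendsto_cong[OF norm_eq[OF Gm]] by simp
  have um': "\<forall>\<^sub>F t in \<F>. ?u t \<in> borel_measurable lebesgue"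
    using \<F>(2) by eventually_elim (rule um)
  show "AE p in lebesgue. H p = G p" if "asymptotic_state \<F> F H" for H
  proof -
    have H: "H \<in> borel_measurable lebesgue" using that by (simp add: asymptotic_state_def)
    then have "((\<lambda>t. L1_norm (\<lambda>p. ?u t p - H p)) \<longlongrightarrow> 0) \<F>"
      using that tendsto_cong[OF norm_eq[OF H]] by (simp add: asymptotic_state_def)
    from L1_limit_unique[OF \<F>(1) um' Gm lim H this] show ?thesis .
  qed
  \<comment> \<open>At a good time 0 \<le> |F| \<le> M holds a.e. in phase space, which has positive
    measure, so there is a point where \<open>M\<close> is nonnegative.\<close>
  have "\<exists>q. 0 \<le> M q"
  proof -
    have "\<exists>p. \<bar>?u (\<tau> 0) p\<bar> \<le> M (stream (p, \<tau> 0))"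
    proof (rule ccontr)
      assume "\<not> ?thesis"
      with \<tau>(5)[of 0] have "AE p in (lborel :: ((real ^ 'n) \<times> (real ^ 'n)) measure). False"
        by (auto elim!: eventually_mono)
      then have "emeasure lborel (UNIV :: ((real ^ 'n) \<times> (real ^ 'n)) set) = 0"
        by (subst (asm) AE_iff_measurable[of UNIV]) auto
      then show False by simp
    qed
    then show ?thesis by (meson abs_ge_zero order_trans)
  qed
  note bound = maxwellian_stream_limit[OF M \<tau>(2) this]
  have "AE p in lebesgue. \<bar>G p\<bar> \<le> M (fst p, snd p, 0)"
  proof (rule L1_limit_bound)
    show "?u (\<tau> n) \<in> borel_measurable lebesgue" for n by (rule um[OF \<tau>(3)])
    show "G \<in> borel_measurable lebesgue" by (rule Gm)
    show "(\<lambda>n. L1_norm (\<lambda>p. ?u (\<tau> n) p - G p)) \<longlonglongrightarrow> 0"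
      using filterlim_compose[OF lim \<tau>(1)] .
    show "AE p in lebesgue. \<bar>?u (\<tau> n) p\<bar> \<le> M (stream (p, \<tau> n))" for n
      using \<tau>(5) by (rule AE_completion)
    show "\<exists>l. (\<lambda>n. M (stream (p, \<tau> n))) \<longlonglongrightarrow> l \<and> l \<le> M (fst p, snd p, 0)" for p by (rule bound)
  qed
  then show "AE (v, x) in lebesgue. \<bar>G (v, x)\<bar> \<le> M (v, x, 0)" by (simp add: case_prod_beta')
qed

section \<open>Sequences of good times, and the conclusion in both time directions\<close>

lemma AE_sequence_at_top:
  "\<forall>P. (AE t in lborel. P (t::real)) \<longrightarrow> (\<exists>\<tau>. filterlim \<tau> at_top sequentially \<and>
    filterlim \<tau> at_infinity sequentially \<and> (\<forall>n::nat. \<tau> n \<in> {t0<..} \<and> P (\<tau> n)))"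
proof (intro allI impI)
  fix P assume P: "AE t in lborel. P (t::real)"
  have "\<exists>t. max t0 (real n) < t \<and> t < max t0 (real n) + 1 \<and> P t" for n
    by (rule AE_lborel_exists[OF P]) simp
  then obtain \<tau> where \<tau>: "\<And>n. max t0 (real n) < \<tau> n \<and> P (\<tau> n)" by metis
  have "filterlim \<tau> at_top sequentially"
    by (rule filterlim_at_top_mono[OF filterlim_real_sequentially]) (use \<tau> in \<open>auto intro!: always_eventually less_imp_le\<close>)
  moreover from this have "filterlim \<tau> at_infinity sequentially"
    by (rule filterlim_mono) (simp_all add: at_top_le_at_infinity)
  ultimately show "\<exists>\<tau>. filterlim \<tau> at_top sequentially \<and>
    filterlim \<tau> at_infinity sequentially \<and> (\<forall>n::nat. \<tau> n \<in> {t0<..} \<and> P (\<tau> n))"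
    using \<tau> by auto
qed

lemma AE_sequence_at_bot:
  "\<forall>P. (AE t in lborel. P (t::real)) \<longrightarrow> (\<exists>\<tau>. filterlim \<tau> at_bot sequentially \<and>
    filterlim \<tau> at_infinity sequentially \<and> (\<forall>n::nat. \<tau> n \<in> {..<t0} \<and> P (\<tau> n)))"
proof (intro allI impI)
  fix P assume P: "AE t in lborel. P (t::real)"
  have "\<exists>t. min t0 (- real n) - 1 < t \<and> t < min t0 (- real n) \<and> P t" for n
    by (rule AE_lborel_exists[OF P]) linarith
  then obtain \<tau> where \<tau>: "\<And>n. \<tau> n < min t0 (- real n) \<and> P (\<tau> n)" by metis
  have "filterlim (\<lambda>n. - \<tau> n) at_top sequentially"
    by (rule filterlim_at_top_mono[OF filterlim_real_sequentially])
      (rule always_eventually, use \<tau> in \<open>smt (verit) min_less_iff_conj\<close>)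
  then have "filterlim \<tau> at_bot sequentially" by (simp add: filterlim_uminus_at_top)
  moreover from this have "filterlim \<tau> at_infinity sequentially"
    by (rule filterlim_mono) (simp_all add: at_bot_le_at_infinity)
  ultimately show "\<exists>\<tau>. filterlim \<tau> at_bot sequentially \<and>
    filterlim \<tau> at_infinity sequentially \<and> (\<forall>n::nat. \<tau> n \<in> {..<t0} \<and> P (\<tau> n))"
    using \<tau> by auto
qed

theorem theorem2p4:
  fixes k :: "real ^ 'n \<Rightarrow> real ^ 'n \<Rightarrow> real"
    and \<beta> t0 :: real
    and F M :: "(real ^ 'n) \<times> (real ^ 'n) \<times> real \<Rightarrow> real"
  assumes "separated_kernel \<beta> k"
    and "1 - real CARD('n) < \<beta>" and "\<beta> \<le> 2"
    and "global_maxwellian M"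
  shows
    "(mild_solution k {t0<..} F \<and>
      (AE (v, x, t) in lebesgue. t \<in> {t0<..} \<longrightarrow> \<bar>F (v, x, t)\<bar> \<le> M (v, x, t)) \<longrightarrow>
      (\<exists>G. asymptotic_state at_top F G \<and>
         (\<forall>H. asymptotic_state at_top F H \<longrightarrow> (AE p in lebesgue. H p = G p)) \<and>
         (0 \<in> {t0<..} \<longrightarrow>
           (AE p in lebesgue.
              interval_lebesgue_integrable lebesgue 0 \<infinity>
                (\<lambda>s. transport s (at_time (collision k F) s) p) \<and>
              G p = at_time F 0 p
                + (LINT s=0..\<infinity>|lebesgue. transport s (at_time (collision k F) s) p))) \<and>
         (AE (v, x) in lebesgue. \<bar>G (v, x)\<bar> \<le> M (v, x, 0))))
     \<and>
     (mild_solution k {..<t0} F \<and>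
      (AE (v, x, t) in lebesgue. t \<in> {..<t0} \<longrightarrow> \<bar>F (v, x, t)\<bar> \<le> M (v, x, t)) \<longrightarrow>
      (\<exists>G. asymptotic_state at_bot F G \<and>
         (\<forall>H. asymptotic_state at_bot F H \<longrightarrow> (AE p in lebesgue. H p = G p)) \<and>
         (0 \<in> {..<t0} \<longrightarrow>
           (AE p in lebesgue.
              interval_lebesgue_integrable lebesgue (-\<infinity>) 0
                (\<lambda>s. transport s (at_time (collision k F) s) p) \<and>
              G p = at_time F 0 p
                - (LINT s=-\<infinity>..0|lebesgue. transport s (at_time (collision k F) s) p))) \<and>
         (AE (v, x) in lebesgue. \<bar>G (v, x)\<bar> \<le> M (v, x, 0))))"
proof (intro conjI impI; elim conjE)
  assume F: "mild_solution k {t0<..} F"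
    and "AE (v, x, t) in lebesgue. t \<in> {t0<..} \<longrightarrow> \<bar>F (v, x, t)\<bar> \<le> M (v, x, t)"
  then have FM: "AE (v, x, t) in lborel. t \<in> {t0<..} \<longrightarrow> \<bar>F (v, x, t)\<bar> \<le> M (v, x, t)"
    by (simp only: AE_completion_iff)
  have I: "open {t0<..}" "is_interval {t0<..}" by (simp_all add: is_interval_oi)
  obtain f where f: "integrable lborel f"
    and rep: "AE p in lborel. integrable lborel (\<lambda>s. f (p, s)) \<and>
      (AE s in lborel. s \<in> {t0<..} \<longrightarrow> transport s (at_time (collision k F) s) p = f (p, s))"
    and Ff: "\<forall>t1\<in>{t0<..}. \<forall>t2\<in>{t0<..}. AE p in lborel. F (stream (p, t2)) = F (stream (p, t1))
      + ((LINT s|lborel. indicator {..t2} s * f (p, s)) - (LINT s|lborel. indicator {..t1} s * f (p, s)))"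
    using mild_solution_cumulative[OF assms(1,2,4) I F FM] by blast
  \<comment> \<open>The state does not depend a.e. on the reference time; taking 0 whenever it is
    admissible makes the formula with the initial datum the definition of \<open>G\<close>.\<close>
  define t1 where "t1 = (if t0 < 0 then 0 else t0 + 1)"
  have t1: "t1 \<in> {t0<..}" by (simp add: t1_def)
  define G where "G = (\<lambda>p. F (stream (p, t1)) - (LINT s|lborel. indicator {..t1} s * f (p, s)) + (LINT s|lborel. f (p, s)))"
  have Lm: "(\<lambda>p. LINT s|lborel. f (p, s)) \<in> borel_measurable borel"
    using borel_measurable_cumulative[of f UNIV] borel_measurable_integrable[OF f] by simp
  have L1: "L1_loc (UNIV \<times> UNIV \<times> {t0<..}) F" using F by (simp add: mild_solution_def)
  have ev: "\<forall>\<^sub>F t in at_top. t \<in> {t0<..}" by (simp add: eventually_gt_at_top)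
  note sc = mild_solution_scattering[OF assms(4) I(1) L1 FM f Ff trivial_limit_at_top_linorder ev t1 Lm
      tail_integral_tendsto(1)[OF f] AE_sequence_at_top G_def]
  have formula: "AE p in lebesgue. interval_lebesgue_integrable lebesgue 0 \<infinity> (\<lambda>s. transport s (at_time (collision k F) s) p) \<and>
      G p = at_time F 0 p + (LINT s=0..\<infinity>|lebesgue. transport s (at_time (collision k F) s) p)"
    if t0: "0 \<in> {t0<..}"
    using rep[THEN AE_completion]
  proof eventually_elim
    case (elim p)
    then have i: "integrable lborel (\<lambda>s. f (p, s))"
      and ae: "AE s in lborel. s \<in> {0<..} \<longrightarrow> transport s (at_time (collision k F) s) p = f (p, s)"
      using t0 by (auto elim!: eventually_mono)
    note s = set_integral_lebesgue_AE[OF i ae]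
    \<comment> \<open>The whole integral minus the cumulative one at \<open>t1 = 0\<close> is the
      integral over \<open>{0<..}\<close>, the set behind the interval integral from 0 to
      \<infinity>.\<close>
    have "(LINT s|lborel. indicator {0<..} s * f (p, s)) = (LINT s|lborel. f (p, s) - indicator {..0} s * f (p, s))"
      by (rule Bochner_Integration.integral_cong) (auto simp: indicator_def)
    also have "\<dots> = (LINT s|lborel. f (p, s)) - (LINT s|lborel. indicator {..0} s * f (p, s))"
      using integrable_mult_indicator[OF _ i, of "{..0}"]
      by (intro Bochner_Integration.integral_diff i) simp
    finally have "G p = at_time F 0 p + (LINT s:{0<..}|lebesgue. transport s (at_time (collision k F) s) p)"
      using t0 s(2) by (simp add: G_def t1_def transport_at_time[symmetric]) (simp add: transport_def at_time_def case_prod_beta')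
    moreover have "einterval 0 \<infinity> = {0<..}"
      by (auto simp: einterval_def)
    ultimately show ?case
      using s(1) by (simp add: interval_lebesgue_integral_def interval_lebesgue_integrable_def)
  qed
  show "\<exists>G. asymptotic_state at_top F G \<and>
         (\<forall>H. asymptotic_state at_top F H \<longrightarrow> (AE p in lebesgue. H p = G p)) \<and>
         (0 \<in> {t0<..} \<longrightarrow>
           (AE p in lebesgue.
              interval_lebesgue_integrable lebesgue 0 \<infinity>
                (\<lambda>s. transport s (at_time (collision k F) s) p) \<and>
              G p = at_time F 0 p
                + (LINT s=0..\<infinity>|lebesgue. transport s (at_time (collision k F) s) p))) \<and>
         (AE (v, x) in lebesgue. \<bar>G (v, x)\<bar> \<le> M (v, x, 0))"
    by (intro exI[of _ G] conjI allI impI sc formula)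
next
  assume F: "mild_solution k {..<t0} F"
    and "AE (v, x, t) in lebesgue. t \<in> {..<t0} \<longrightarrow> \<bar>F (v, x, t)\<bar> \<le> M (v, x, t)"
  then have FM: "AE (v, x, t) in lborel. t \<in> {..<t0} \<longrightarrow> \<bar>F (v, x, t)\<bar> \<le> M (v, x, t)"
    by (simp only: AE_completion_iff)
  have I: "open {..<t0}" "is_interval {..<t0}" by (simp_all add: is_interval_io)
  obtain f where f: "integrable lborel f"
    and rep: "AE p in lborel. integrable lborel (\<lambda>s. f (p, s)) \<and>
      (AE s in lborel. s \<in> {..<t0} \<longrightarrow> transport s (at_time (collision k F) s) p = f (p, s))"
    and Ff: "\<forall>t1\<in>{..<t0}. \<forall>t2\<in>{..<t0}. AE p in lborel. F (stream (p, t2)) = F (stream (p, t1))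
      + ((LINT s|lborel. indicator {..t2} s * f (p, s)) - (LINT s|lborel. indicator {..t1} s * f (p, s)))"
    using mild_solution_cumulative[OF assms(1,2,4) I F FM] by blast
  define t1 where "t1 = (if 0 < t0 then 0 else t0 - 1)"
  have t1: "t1 \<in> {..<t0}" by (simp add: t1_def)
  \<comment> \<open>Towards -\<infinity> the cumulative integral tends to \<open>0\<close>, which is
    therefore the limit L here; the minus sign in the formula for the past state is that of the
    cumulative integral at \<open>t1\<close>.\<close>
  define G where "G = (\<lambda>p. F (stream (p, t1)) - (LINT s|lborel. indicator {..t1} s * f (p, s)) + 0)"
  have Lm: "(\<lambda>p. 0::real) \<in> borel_measurable borel" by simp
  have L1: "L1_loc (UNIV \<times> UNIV \<times> {..<t0}) F" using F by (simp add: mild_solution_def)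
  have ev: "\<forall>\<^sub>F t in at_bot. t \<in> {..<t0}" by (simp add: eventually_gt_at_bot)
  note sc = mild_solution_scattering[OF assms(4) I(1) L1 FM f Ff trivial_limit_at_bot_linorder ev t1 Lm
      tail_integral_tendsto(2)[OF f] AE_sequence_at_bot G_def]
  have formula: "AE p in lebesgue. interval_lebesgue_integrable lebesgue (-\<infinity>) 0 (\<lambda>s. transport s (at_time (collision k F) s) p) \<and>
      G p = at_time F 0 p - (LINT s=-\<infinity>..0|lebesgue. transport s (at_time (collision k F) s) p)"
    if t0: "0 \<in> {..<t0}"
    using rep[THEN AE_completion]
  proof eventually_elim
    case (elim p)
    then have i: "integrable lborel (\<lambda>s. f (p, s))"
      and ae: "AE s in lborel. s \<in> {..<0} \<longrightarrow> transport s (at_time (collision k F) s) p = f (p, s)"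
      using t0 by (auto elim!: eventually_mono)
    note s = set_integral_lebesgue_AE[OF i ae]
    \<comment> \<open>The cumulative integral includes the end point 0, the interval integral does
      not.\<close>
    have "(LINT s|lborel. indicator {..<0} s * f (p, s)) = (LINT s|lborel. indicator {..0} s * f (p, s))"
    proof (rule integral_cong_AE)
      show "AE s in lborel. indicator {..<0} s * f (p, s) = indicator {..0} s * f (p, s)"
        using AE_lborel_singleton[of 0] by eventually_elim (auto simp: indicator_def)
    qed (use borel_measurable_integrable[OF i] in auto)
    then have "G p = at_time F 0 p - (LINT s:{..<0}|lebesgue. transport s (at_time (collision k F) s) p)"
      using t0 s(2) by (simp add: G_def t1_def transport_at_time[symmetric]) (simp add: transport_def at_time_def case_prod_beta')
    moreover have "einterval (-\<infinity>) 0 = {..<0}"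
      by (auto simp: einterval_def)
    ultimately show ?case
      using s(1) by (simp add: interval_lebesgue_integral_def interval_lebesgue_integrable_def)
  qed
  show "\<exists>G. asymptotic_state at_bot F G \<and>
         (\<forall>H. asymptotic_state at_bot F H \<longrightarrow> (AE p in lebesgue. H p = G p)) \<and>
         (0 \<in> {..<t0} \<longrightarrow>
           (AE p in lebesgue.
              interval_lebesgue_integrable lebesgue (-\<infinity>) 0
                (\<lambda>s. transport s (at_time (collision k F) s) p) \<and>
              G p = at_time F 0 p
                - (LINT s=-\<infinity>..0|lebesgue. transport s (at_time (collision k F) s) p))) \<and>
         (AE (v, x) in lebesgue. \<bar>G (v, x)\<bar> \<le> M (v, x, 0))"
    by (intro exI[of _ G] conjI allI impI sc formula)
qed

end
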